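(* Let $B \subseteq \mathbb{N}$ be a set which is not arithmetic. Then for every tournament $T$ on $\mathbb{N}$ there is an infinite set $H \subseteq \mathbb{N}$ which is $T$-transitive (i.e., the subtournament of $T$ with domain $H$ is transitive) such that $B$ is not arithmetic relative to $H$.
   Context: A tournament on a domain $D \subseteq \mathbb{N}$ is an irreflexive binary relation $T \subseteq D^2$ such that for all distinct $a,b \in D$ exactly one of $T(a,b)$, $T(b,a)$ holds. It is transitive if $T(a,b)$ and $T(b,c)$ imply $T(a,c)$. A subtournament is the restriction of $T$ to a subdomain $H$, identified with $H$. "$B$ is arithmetic relative to $H$" ($H$-arithmetic) means $B$ is $\Sigma^0_n(H)$ for some $n$. *)

theory Defs
  imports Main
begin

definition tournament_on :: "nat set \<Rightarrow> (nat \<times> nat) set \<Rightarrow> bool" where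
  "tournament_on D T \<longleftrightarrow>
     T \<subseteq> D \<times> D \<and> irrefl T \<and>
     (\<forall>a\<in>D. \<forall>b\<in>D. a \<noteq> b \<longrightarrow> ((a, b) \<in> T) \<noteq> ((b, a) \<in> T))"

definition subtournament :: "(nat \<times> nat) set \<Rightarrow> nat set \<Rightarrow> (nat \<times> nat) set" where
  "subtournament T H = T \<inter> H \<times> H"

definition transitive_subdomain :: "(nat \<times> nat) set \<Rightarrow> nat set \<Rightarrow> bool" where
  "transitive_subdomain T H \<longleftrightarrow> trans (subtournament T H)"


text \<open>
  The relativized arithmetical hierarchy, given by formulas of first-order arithmetic with an
  additional unary predicate for the oracle. Variables are de Bruijn indices. In the bounded
  quantifiers the bounding term lies outside the scope of the quantifier.
\<close>

datatype tm =
    Var nat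
  | Zero
  | Succ tm
  | Plus tm tm
  | Times tm tm

datatype fm =
    Eq tm tm
  | Less tm tm
  | Oracle tm
  | Neg fm
  | Conj fm fm
  | Disj fm fm
  | BAll tm fm
  | BEx tm fm
  | All fm
  | Ex fm

primrec val :: "(nat \<Rightarrow> nat) \<Rightarrow> tm \<Rightarrow> nat" where
  "val e (Var i) = e i"
| "val e Zero = 0"
| "val e (Succ t) = Suc (val e t)"
| "val e (Plus s t) = val e s + val e t"
| "val e (Times s t) = val e s * val e t"

primrec sat :: "nat set \<Rightarrow> (nat \<Rightarrow> nat) \<Rightarrow> fm \<Rightarrow> bool" where
  "sat X e (Eq s t) \<longleftrightarrow> val e s = val e t"
| "sat X e (Less s t) \<longleftrightarrow> val e s < val e t"
| "sat X e (Oracle t) \<longleftrightarrow> val e t \<in> X"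
| "sat X e (Neg p) \<longleftrightarrow> \<not> sat X e p"
| "sat X e (Conj p q) \<longleftrightarrow> sat X e p \<and> sat X e q"
| "sat X e (Disj p q) \<longleftrightarrow> sat X e p \<or> sat X e q"
| "sat X e (BAll t p) \<longleftrightarrow> (\<forall>a < val e t. sat X (case_nat a e) p)"
| "sat X e (BEx t p) \<longleftrightarrow> (\<exists>a < val e t. sat X (case_nat a e) p)"
| "sat X e (All p) \<longleftrightarrow> (\<forall>a. sat X (case_nat a e) p)"
| "sat X e (Ex p) \<longleftrightarrow> (\<exists>a. sat X (case_nat a e) p)"

primrec bounded_fm :: "fm \<Rightarrow> bool" where
  "bounded_fm (Eq s t) \<longleftrightarrow> True"
| "bounded_fm (Less s t) \<longleftrightarrow> True"
| "bounded_fm (Oracle t) \<longleftrightarrow> True"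
| "bounded_fm (Neg p) \<longleftrightarrow> bounded_fm p"
| "bounded_fm (Conj p q) \<longleftrightarrow> bounded_fm p \<and> bounded_fm q"
| "bounded_fm (Disj p q) \<longleftrightarrow> bounded_fm p \<and> bounded_fm q"
| "bounded_fm (BAll t p) \<longleftrightarrow> bounded_fm p"
| "bounded_fm (BEx t p) \<longleftrightarrow> bounded_fm p"
| "bounded_fm (All p) \<longleftrightarrow> False"
| "bounded_fm (Ex p) \<longleftrightarrow> False"

text \<open>
  Prenex formulas with \<open>n\<close> alternating, possibly empty, blocks of unbounded quantifiers
  in front of a bounded matrix.
\<close>

inductive Sigma_fm :: "nat \<Rightarrow> fm \<Rightarrow> bool" and Pi_fm :: "nat \<Rightarrow> fm \<Rightarrow> bool" where
  Sigma_bounded: "bounded_fm p \<Longrightarrow> Sigma_fm 0 p"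
| Pi_bounded: "bounded_fm p \<Longrightarrow> Pi_fm 0 p"
| Sigma_Pi: "Pi_fm n p \<Longrightarrow> Sigma_fm (Suc n) p"
| Sigma_Ex: "Sigma_fm (Suc n) p \<Longrightarrow> Sigma_fm (Suc n) (Ex p)"
| Pi_Sigma: "Sigma_fm n p \<Longrightarrow> Pi_fm (Suc n) p"
| Pi_All: "Pi_fm (Suc n) p \<Longrightarrow> Pi_fm (Suc n) (All p)"

text \<open>
  The set defined by a formula in the free variable with index 0. All other free variables
  denote 0, so number parameters play no role.
\<close>

definition defines_set :: "nat set \<Rightarrow> fm \<Rightarrow> nat set \<Rightarrow> bool" where
  "defines_set X p B \<longleftrightarrow> B = {x. sat X (case_nat x (\<lambda>_. 0)) p}"

definition Sigma_in :: "nat \<Rightarrow> nat set \<Rightarrow> nat set \<Rightarrow> bool" where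
  "Sigma_in n X B \<longleftrightarrow> (\<exists>p. Sigma_fm n p \<and> defines_set X p B)"

definition arithmetic_in :: "nat set \<Rightarrow> nat set \<Rightarrow> bool" where
  "arithmetic_in X B \<longleftrightarrow> (\<exists>n. Sigma_in n X B)"

definition arithmetic :: "nat set \<Rightarrow> bool" where
  "arithmetic B \<longleftrightarrow> arithmetic_in {} B"

end

theory Submission
  imports Defs "HOL-Library.Nat_Bijection" "HOL-Library.Countable"
begin

text \<open>
  Call a collection \<open>D\<close> of families of finite sets consistent if, for any finitely many colourings
  and tournaments, some monochromatic set contains from each of any finitely many families of \<open>D\<close>
  a member that is transitive for all these tournaments. By compactness, consistency of finite
  collections is an arithmetical property, so families that come in an arithmetical sequence can be
  decided greedily, one after the other, by an arithmetical procedure. The forcing relation for a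
  formula depends only on which families belong to \<open>D\<close>, hence, building \<open>D\<close> by infinitely many such
  steps, it becomes arithmetical for every single formula, although it refers to no tournament.

  A consistent \<open>D\<close> gives an ultrafilter each of whose sets contains, for each family of \<open>D\<close>
  and any finitely many tournaments, a member of the family that is transitive for all of them; and
  a family that cannot be added consistently to \<open>D\<close> is avoided under one such restriction. Conditions \<open>(\<sigma>, R)\<close>, where \<open>R\<close> is the
  family of finite subsets of a set in the ultrafilter that are transitive for finitely many
  tournaments, including the given one, build a generic transitive set. The set of \<open>x\<close> for which
  some extension of a condition forces \<open>\<phi>(x)\<close> is arithmetical, hence different from \<open>B\<close>, and
  so \<open>\<phi>\<close> can be made not to define \<open>B\<close>.
\<close>

section \<open>Arithmetical predicates on environments\<close>

primrec rename_tm :: "(nat \<Rightarrow> nat) \<Rightarrow> tm \<Rightarrow> tm" where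
  "rename_tm r (Var i) = Var (r i)"
| "rename_tm r Zero = Zero"
| "rename_tm r (Succ t) = Succ (rename_tm r t)"
| "rename_tm r (Plus s t) = Plus (rename_tm r s) (rename_tm r t)"
| "rename_tm r (Times s t) = Times (rename_tm r s) (rename_tm r t)"

lemma val_rename_tm [simp]: "val e (rename_tm r t) = val (\<lambda>n. e (r n)) t"
  by (induction t) auto

abbreviation under_binder :: "(nat \<Rightarrow> nat) \<Rightarrow> nat \<Rightarrow> nat" where
  "under_binder r \<equiv> case_nat 0 (\<lambda>n. Suc (r n))"

primrec rename :: "(nat \<Rightarrow> nat) \<Rightarrow> fm \<Rightarrow> fm" where
  "rename r (Eq s t) = Eq (rename_tm r s) (rename_tm r t)"
| "rename r (Less s t) = Less (rename_tm r s) (rename_tm r t)"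
| "rename r (Oracle t) = Oracle (rename_tm r t)"
| "rename r (Neg p) = Neg (rename r p)"
| "rename r (Conj p q) = Conj (rename r p) (rename r q)"
| "rename r (Disj p q) = Disj (rename r p) (rename r q)"
| "rename r (BAll t p) = BAll (rename_tm r t) (rename (under_binder r) p)"
| "rename r (BEx t p) = BEx (rename_tm r t) (rename (under_binder r) p)"
| "rename r (All p) = All (rename (under_binder r) p)"
| "rename r (Ex p) = Ex (rename (under_binder r) p)"

lemma case_nat_under_binder [simp]:
  "(\<lambda>n. case_nat a e (under_binder r n)) = case_nat a (\<lambda>n. e (r n))"
  by (rule ext) (simp split: nat.split)

lemma sat_rename [simp]: "sat X e (rename r p) = sat X (\<lambda>n. e (r n)) p"
  by (induction p arbitrary: e r) auto

lemma bounded_fm_rename [simp]: "bounded_fm (rename r p) = bounded_fm p"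
  by (induction p arbitrary: r) auto

text \<open>Quantifiers may be mixed in any order, so closure under connectives needs no count of
  alternations; \<open>prenex_imp_Sigma_fm\<close> finds some level afterwards.\<close>

inductive prenex :: "fm \<Rightarrow> bool" where
  prenex_bounded: "bounded_fm p \<Longrightarrow> prenex p"
| prenex_Ex: "prenex p \<Longrightarrow> prenex (Ex p)"
| prenex_All: "prenex p \<Longrightarrow> prenex (All p)"

lemma prenex_rename: "prenex p \<Longrightarrow> prenex (rename r p)"
  by (induction arbitrary: r rule: prenex.induct) (auto intro: prenex.intros)

lemma prenex_imp_Sigma_fm: "prenex p \<Longrightarrow> \<exists>n. Sigma_fm n p"
proof (induction rule: prenex.induct)
  case (prenex_bounded p)
  then show ?case by (blast intro: Sigma_bounded)
next
  case (prenex_Ex p)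
  then obtain n where "Sigma_fm n p" by blast
  then have "Sigma_fm (Suc (Suc n)) p" by (blast intro: Sigma_Pi Pi_Sigma)
  then show ?case by (blast intro: Sigma_Ex)
next
  case (prenex_All p)
  then obtain n where "Sigma_fm n p" by blast
  then have "Pi_fm (Suc n) (All p)" by (blast intro: Pi_Sigma Pi_All)
  then show ?case by (blast intro: Sigma_Pi)
qed

lemma prenex_neg: "prenex p \<Longrightarrow> \<exists>q. prenex q \<and> (\<forall>X e. sat X e q \<longleftrightarrow> \<not> sat X e p)"
proof (induction rule: prenex.induct)
  case (prenex_bounded p)
  then have "prenex (Neg p)" by (auto intro: prenex.prenex_bounded)
  then show ?case by (intro exI[of _ "Neg p"]) simp
next
  case (prenex_Ex p)
  then obtain q where "prenex q" "\<forall>X e. sat X e q \<longleftrightarrow> \<not> sat X e p" by blast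
  then show ?case by (intro exI[of _ "All q"]) (simp add: prenex.prenex_All)
next
  case (prenex_All p)
  then obtain q where "prenex q" "\<forall>X e. sat X e q \<longleftrightarrow> \<not> sat X e p" by blast
  then show ?case by (intro exI[of _ "Ex q"]) (simp add: prenex.prenex_Ex)
qed

text \<open>The quantifiers of \<open>q\<close> are pulled out one at a time;
  \<open>rename Suc\<close> shifts the variables of \<open>p\<close> past each of them.\<close>

lemma prenex_conj_bounded:
  "prenex q \<Longrightarrow> bounded_fm p \<Longrightarrow>
     \<exists>r. prenex r \<and> (\<forall>X e. sat X e r \<longleftrightarrow> sat X e p \<and> sat X e q)"
proof (induction arbitrary: p rule: prenex.induct)
  case (prenex_bounded q)
  then have "prenex (Conj p q)" by (auto intro: prenex.prenex_bounded)
  then show ?case by (intro exI[of _ "Conj p q"]) simp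
next
  case (prenex_Ex q)
  obtain r where "prenex r" "\<forall>X e. sat X e r \<longleftrightarrow> sat X e (rename Suc p) \<and> sat X e q"
    using prenex_Ex.IH[of "rename Suc p"] prenex_Ex.prems by auto
  then show ?case by (intro exI[of _ "Ex r"]) (simp add: prenex.prenex_Ex)
next
  case (prenex_All q)
  obtain r where "prenex r" "\<forall>X e. sat X e r \<longleftrightarrow> sat X e (rename Suc p) \<and> sat X e q"
    using prenex_All.IH[of "rename Suc p"] prenex_All.prems by auto
  then show ?case by (intro exI[of _ "All r"]) (simp add: prenex.prenex_All)
qed

lemma prenex_conj:
  "prenex p \<Longrightarrow> prenex q \<Longrightarrow>
     \<exists>r. prenex r \<and> (\<forall>X e. sat X e r \<longleftrightarrow> sat X e p \<and> sat X e q)"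
proof (induction arbitrary: q rule: prenex.induct)
  case (prenex_bounded p)
  then show ?case using prenex_conj_bounded by blast
next
  case (prenex_Ex p)
  obtain r where "prenex r" "\<forall>X e. sat X e r \<longleftrightarrow> sat X e p \<and> sat X e (rename Suc q)"
    using prenex_Ex.IH[OF prenex_rename[OF prenex_Ex.prems, of Suc]] by blast
  then show ?case by (intro exI[of _ "Ex r"]) (simp add: prenex.prenex_Ex)
next
  case (prenex_All p)
  obtain r where "prenex r" "\<forall>X e. sat X e r \<longleftrightarrow> sat X e p \<and> sat X e (rename Suc q)"
    using prenex_All.IH[OF prenex_rename[OF prenex_All.prems, of Suc]] by blast
  then show ?case by (intro exI[of _ "All r"]) (simp add: prenex.prenex_All)
qed

section \<open>Closure properties of arithmetical predicates and functions\<close>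

definition definable :: "((nat \<Rightarrow> nat) \<Rightarrow> bool) \<Rightarrow> bool" where
  "definable P \<longleftrightarrow> (\<exists>p. prenex p \<and> (\<forall>e. sat {} e p \<longleftrightarrow> P e))"

definition definable_fun :: "((nat \<Rightarrow> nat) \<Rightarrow> nat) \<Rightarrow> bool" where
  "definable_fun f \<longleftrightarrow> definable (\<lambda>e. e 0 = f (\<lambda>n. e (Suc n)))"

lemma definable_imp_arithmetic:
  assumes "definable (\<lambda>e. Q (e 0))"
  shows "arithmetic {x. Q x}"
proof -
  from assms obtain p where p: "prenex p" "\<forall>e. sat {} e p \<longleftrightarrow> Q (e 0)"
    unfolding definable_def by blast
  from prenex_imp_Sigma_fm[OF p(1)] obtain n where "Sigma_fm n p" by blast
  moreover have "defines_set {} p {x. Q x}"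
    using p(2) by (simp add: defines_set_def)
  ultimately show ?thesis
    unfolding arithmetic_def arithmetic_in_def Sigma_in_def by blast
qed

lemma definable_not: "definable P \<Longrightarrow> definable (\<lambda>e. \<not> P e)"
  unfolding definable_def by (blast dest: prenex_neg)

lemma definable_conj:
  assumes "definable P" "definable Q"
  shows "definable (\<lambda>e. P e \<and> Q e)"
proof -
  from assms obtain p q where "prenex p" "\<forall>e. sat {} e p \<longleftrightarrow> P e"
    "prenex q" "\<forall>e. sat {} e q \<longleftrightarrow> Q e"
    unfolding definable_def by blast
  with prenex_conj[of p q] show ?thesis unfolding definable_def by auto
qed

lemma definable_disj: "definable P \<Longrightarrow> definable Q \<Longrightarrow> definable (\<lambda>e. P e \<or> Q e)"
  using definable_not[OF definable_conj[OF definable_not[of P] definable_not[of Q]]] by simp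

lemma definable_imp: "definable P \<Longrightarrow> definable Q \<Longrightarrow> definable (\<lambda>e. P e \<longrightarrow> Q e)"
  unfolding imp_conv_disj by (intro definable_disj definable_not)

lemma definable_iff: "definable P \<Longrightarrow> definable Q \<Longrightarrow> definable (\<lambda>e. P e \<longleftrightarrow> Q e)"
  unfolding iff_conv_conj_imp by (intro definable_conj definable_imp)

lemma definable_Ex:
  assumes "definable (\<lambda>e. P (\<lambda>n. e (Suc n)) (e 0))"
  shows "definable (\<lambda>e. \<exists>x. P e x)"
proof -
  from assms obtain p where p: "prenex p" "\<forall>e. sat {} e p \<longleftrightarrow> P (\<lambda>n. e (Suc n)) (e 0)"
    unfolding definable_def by blast
  then show ?thesis
    unfolding definable_def by (intro exI[of _ "Ex p"]) (simp add: prenex_Ex)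
qed

lemma definable_All:
  assumes "definable (\<lambda>e. P (\<lambda>n. e (Suc n)) (e 0))"
  shows "definable (\<lambda>e. \<forall>x. P e x)"
  using definable_not[OF definable_Ex[OF definable_not[OF assms]]] by simp

lemma definable_rename:
  assumes "definable P"
  shows "definable (\<lambda>e. P (\<lambda>n. e (r n)))"
proof -
  from assms obtain p where p: "prenex p" "\<forall>e. sat {} e p \<longleftrightarrow> P e"
    unfolding definable_def by blast
  then show ?thesis
    unfolding definable_def by (intro exI[of _ "rename r p"]) (simp add: prenex_rename)
qed

text \<open>The value of a definable function need not be given by a term, so it is substituted by
  quantifying over it.\<close>

lemma definable_app:
  assumes Q: "definable (\<lambda>e. Q (e 0))" and f: "definable_fun f"
  shows "definable (\<lambda>e. Q (f e))"
proof -
  have "definable (\<lambda>e. \<exists>x. x = f e \<and> Q x)"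
    using f Q unfolding definable_fun_def by (intro definable_Ex definable_conj)
  then show ?thesis by simp
qed

lemma definable_app2:
  assumes Q: "definable (\<lambda>e. Q (e 0) (e (Suc 0)))" and f: "definable_fun f" and g: "definable_fun g"
  shows "definable (\<lambda>e. Q (f e) (g e))"
proof -
  have "definable (\<lambda>e. \<exists>x y. x = f e \<and> y = g e \<and> Q x y)"
  proof (intro definable_Ex definable_conj)
    show "definable (\<lambda>e. e (Suc 0) = f (\<lambda>n. e (Suc (Suc n))))"
      using definable_rename[OF f[unfolded definable_fun_def], of Suc] by simp
    show "definable (\<lambda>e. e 0 = g (\<lambda>n. e (Suc (Suc n))))"
      using definable_rename[OF g[unfolded definable_fun_def], of "case_nat 0 (\<lambda>n. Suc (Suc n))"] by simp
    show "definable (\<lambda>e. Q (e (Suc 0)) (e 0))"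
      using definable_rename[OF Q, of "\<lambda>n. if n = 0 then Suc 0 else 0"] by simp
  qed
  then show ?thesis by simp
qed

lemma definable_bounded_fm:
  assumes "bounded_fm p" "\<And>e. sat {} e p \<longleftrightarrow> P e"
  shows "definable P"
  unfolding definable_def using assms by (blast intro: prenex_bounded)

lemma definable_eq_var: "definable (\<lambda>e. e i = e j)"
  by (rule definable_bounded_fm[of "Eq (Var i) (Var j)"]) auto

lemma definable_eq: "definable_fun f \<Longrightarrow> definable_fun g \<Longrightarrow> definable (\<lambda>e. f e = g e)"
  by (rule definable_app2[where Q = "(=)", OF definable_eq_var])

lemma definable_less: "definable_fun f \<Longrightarrow> definable_fun g \<Longrightarrow> definable (\<lambda>e. f e < g e)"
  by (rule definable_app2[OF definable_bounded_fm[of "Less (Var 0) (Var (Suc 0))"]]) auto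

lemma definable_fun_var: "definable_fun (\<lambda>e. e i)"
  unfolding definable_fun_def by (rule definable_eq_var)

lemma definable_fun_compose:
  assumes h: "definable (\<lambda>e. e 0 = h (e (Suc 0)))" and f: "definable_fun f"
  shows "definable_fun (\<lambda>e. h (f e))"
  unfolding definable_fun_def
proof (rule definable_app2[where Q = "\<lambda>x y. x = h y", OF h definable_fun_var])
  show "definable_fun (\<lambda>e. f (\<lambda>n. e (Suc n)))"
    using definable_rename[OF f[unfolded definable_fun_def], of "case_nat 0 (\<lambda>n. Suc (Suc n))"]
    unfolding definable_fun_def by simp
qed

lemma definable_fun_compose2:
  assumes h: "definable (\<lambda>e. e 0 = h (e (Suc 0)) (e (Suc (Suc 0))))"
    and f: "definable_fun f" and g: "definable_fun g"
  shows "definable_fun (\<lambda>e. h (f e) (g e))"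
proof -
  have "definable (\<lambda>e. \<exists>x y. x = f (\<lambda>n. e (Suc n)) \<and> y = g (\<lambda>n. e (Suc n)) \<and> e 0 = h x y)"
  proof (intro definable_Ex definable_conj)
    show "definable (\<lambda>e. e (Suc 0) = f (\<lambda>n. e (Suc (Suc (Suc n)))))"
      using definable_rename[OF f[unfolded definable_fun_def], of "case_nat (Suc 0) (\<lambda>n. Suc (Suc (Suc n)))"] by simp
    show "definable (\<lambda>e. e 0 = g (\<lambda>n. e (Suc (Suc (Suc n)))))"
      using definable_rename[OF g[unfolded definable_fun_def], of "case_nat 0 (\<lambda>n. Suc (Suc (Suc n)))"] by simp
    show "definable (\<lambda>e. e (Suc (Suc 0)) = h (e (Suc 0)) (e 0))"
      \<comment> \<open>Under the two quantifiers \<open>y\<close>, \<open>x\<close> and the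
        function value have indices 0, 1 and 2, the reverse of the order in
        \<open>h\<close>.\<close>
      using definable_rename[OF h, of "\<lambda>n. 2 - n"] by (simp add: numeral_2_eq_2)
  qed
  then show ?thesis unfolding definable_fun_def by simp
qed

lemma definable_fun_const: "definable_fun (\<lambda>_. c)"
proof (induction c)
  case 0
  show ?case unfolding definable_fun_def
    by (rule definable_bounded_fm[of "Eq (Var 0) Zero"]) auto
next
  case (Suc c)
  show ?case
    by (rule definable_fun_compose[of Suc, OF _ Suc],
        rule definable_bounded_fm[of "Eq (Var 0) (Succ (Var (Suc 0)))"]) auto
qed

lemma definable_fun_Suc: "definable_fun f \<Longrightarrow> definable_fun (\<lambda>e. Suc (f e))"
  by (rule definable_fun_compose,
      rule definable_bounded_fm[of "Eq (Var 0) (Succ (Var (Suc 0)))"]) auto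

lemma definable_fun_plus:
  "definable_fun f \<Longrightarrow> definable_fun g \<Longrightarrow> definable_fun (\<lambda>e. f e + g e)"
  by (rule definable_fun_compose2,
      rule definable_bounded_fm[of "Eq (Var 0) (Plus (Var (Suc 0)) (Var (Suc (Suc 0))))"]) auto

lemma definable_fun_times:
  "definable_fun f \<Longrightarrow> definable_fun g \<Longrightarrow> definable_fun (\<lambda>e. f e * g e)"
  by (rule definable_fun_compose2,
      rule definable_bounded_fm[of "Eq (Var 0) (Times (Var (Suc 0)) (Var (Suc (Suc 0))))"]) auto

lemmas definable_intros =
  definable_not definable_conj definable_disj definable_imp definable_iff definable_Ex definable_All
  definable_eq definable_less definable_fun_var definable_fun_const definable_fun_Suc
  definable_fun_plus definable_fun_times

subsection \<open>Coding\<close>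

text \<open>Doubling clears the division in the triangular number, so the graph of pairing is a
  polynomial equation.\<close>

lemma eq_prod_encode_iff: "z = prod_encode (x, y) \<longleftrightarrow> 2 * z = (x + y) * Suc (x + y) + 2 * x"
proof -
  have "2 * prod_encode (x, y) = (x + y) * Suc (x + y) + 2 * x"
    by (simp add: prod_encode_def triangle_def)
  then show ?thesis by linarith
qed

lemma definable_fun_prod_encode:
  "definable_fun f \<Longrightarrow> definable_fun g \<Longrightarrow> definable_fun (\<lambda>e. prod_encode (f e, g e))"
  by (rule definable_fun_compose2[where h = "\<lambda>x y. prod_encode (x, y)"])
    (unfold eq_prod_encode_iff, intro definable_intros)

lemma eq_fst_prod_decode_iff: "x = fst (prod_decode z) \<longleftrightarrow> (\<exists>y. z = prod_encode (x, y))"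
  by (metis fst_conv prod.collapse prod_decode_inverse prod_encode_inverse)

lemma eq_snd_prod_decode_iff: "y = snd (prod_decode z) \<longleftrightarrow> (\<exists>x. z = prod_encode (x, y))"
  by (metis snd_conv prod.collapse prod_decode_inverse prod_encode_inverse)

lemma definable_fun_fst: "definable_fun f \<Longrightarrow> definable_fun (\<lambda>e. fst (prod_decode (f e)))"
  by (rule definable_fun_compose[where h = "\<lambda>x. fst (prod_decode x)"])
    (unfold eq_fst_prod_decode_iff, intro definable_fun_prod_encode definable_intros)

lemma definable_fun_snd: "definable_fun f \<Longrightarrow> definable_fun (\<lambda>e. snd (prod_decode (f e)))"
  by (rule definable_fun_compose[where h = "\<lambda>x. snd (prod_decode x)"])
    (unfold eq_snd_prod_decode_iff, intro definable_fun_prod_encode definable_intros)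

text \<open>
  A variant of Goedel's \<open>\<beta>\<close>-function: if \<open>b\<close> is divisible by all positive numbers below \<open>n\<close>,
  then the moduli \<open>1 + (x + 1) * b\<close> for \<open>x < n\<close> are pairwise coprime.
\<close>

definition fin_set :: "nat \<Rightarrow> nat set" where
  "fin_set c = (case prod_decode c of (n, d) \<Rightarrow> case prod_decode d of (a, b) \<Rightarrow>
     {x. x < n \<and> Suc (Suc x * b) dvd a})"

lemma finite_fin_set [simp, intro]: "finite (fin_set c)"
  unfolding fin_set_def by (auto split: prod.split)

text \<open>A common divisor divides one more than a multiple of \<open>fact n\<close>, so it is
  coprime to \<open>fact n\<close>. It therefore divides \<open>y - x\<close>, which divides
  \<open>fact n\<close>, and must be a unit.\<close>

lemma coprime_moduli:
  assumes "x < y" "y \<le> n"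
  shows "coprime (Suc (Suc x * fact n)) (Suc (Suc y * fact n) :: nat)"
proof (rule coprimeI)
  fix c :: nat
  assume c: "c dvd Suc (Suc x * fact n)" "c dvd Suc (Suc y * fact n)"
  have "coprime c (fact n)"
  proof (rule coprimeI)
    fix d assume "d dvd c" "d dvd (fact n :: nat)"
    then have "d dvd Suc (Suc x * fact n)" "d dvd Suc x * fact n"
      using c(1) dvd_trans dvd_mult by blast+
    then show "is_unit d" using dvd_add_right_iff[of d "Suc x * fact n" 1] by simp
  qed
  moreover have "c dvd (y - x) * fact n"
  proof -
    have "Suc (Suc y * fact n) - Suc (Suc x * fact n) = (y - x) * fact n"
      using assms(1) by (simp add: diff_mult_distrib)
    then show ?thesis using dvd_diff_nat[OF c(2,1)] by simp
  qed
  ultimately have "c dvd y - x" by (simp add: coprime_dvd_mult_left_iff)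
  also have "y - x dvd fact n" using assms by (intro dvd_fact) auto
  finally have "c dvd Suc x * fact n" by (rule dvd_mult)
  with c(1) show "is_unit c" using dvd_add_right_iff[of c "Suc x * fact n" 1] by simp
qed

text \<open>The code uses the product of the moduli belonging to \<open>A\<close>. The modulus of
  any other \<open>x < n\<close> is coprime to this product, so divisibility recovers
  \<open>A\<close>.\<close>

lemma fin_set_surj:
  assumes "finite A"
  shows "\<exists>c. fin_set c = A"
proof -
  obtain n where n: "\<And>x. x \<in> A \<Longrightarrow> x < n"
    using assms by (metis finite_nat_set_iff_bounded)
  let ?m = "\<lambda>x. Suc (Suc x * fact n) :: nat"
  have cop: "coprime (?m x) (?m y)" if "x < n" "y < n" "x \<noteq> y" for x y
    using coprime_moduli[of x y n] coprime_moduli[of y x n] that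
    by (cases x y rule: linorder_cases) (auto simp: coprime_commute)
  have "?m x dvd prod ?m A \<longleftrightarrow> x \<in> A" if "x < n" for x
  proof
    assume dvd: "?m x dvd prod ?m A"
    show "x \<in> A"
    proof (rule ccontr)
      assume "x \<notin> A"
      then have "coprime (?m x) (prod ?m A)"
        using cop n that by (intro prod_coprime_right) metis
      with dvd have "is_unit (?m x)" using coprime_common_divisor dvd_refl by blast
      then show False by simp
    qed
  qed (use assms in \<open>rule dvd_prodI\<close>)
  then have "fin_set (prod_encode (n, prod_encode (prod ?m A, fact n))) = A"
    using n by (auto simp: fin_set_def)
  then show ?thesis by blast
qed

lemma definable_mem:
  assumes "definable_fun f" "definable_fun g"
  shows "definable (\<lambda>e. f e \<in> fin_set (g e))"
proof (rule definable_app2[where Q = "\<lambda>x c. x \<in> fin_set c", OF _ assms])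
  have eq: "x \<in> fin_set c \<longleftrightarrow> (\<exists>n a b k. c = prod_encode (n, prod_encode (a, b)) \<and> x < n \<and>
      a = Suc (Suc x * b) * k)" for x c
  proof -
    obtain n a b where "c = prod_encode (n, prod_encode (a, b))"
      by (metis prod_decode_inverse surj_pair)
    then show ?thesis by (auto simp: fin_set_def dvd_def simp del: mult_Suc)
  qed
  show "definable (\<lambda>e. e 0 \<in> fin_set (e (Suc 0)))"
    unfolding eq by (intro definable_fun_prod_encode definable_intros)
qed

lemma definable_Ball:
  assumes "definable_fun f" "definable (\<lambda>e. P (\<lambda>n. e (Suc n)) (e 0))"
  shows "definable (\<lambda>e. \<forall>x\<in>fin_set (f e). P e x)"
proof -
  have "definable_fun (\<lambda>e. f (\<lambda>n. e (Suc n)))"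
    using definable_rename[OF assms(1)[unfolded definable_fun_def], of "case_nat 0 (\<lambda>n. Suc (Suc n))"]
    unfolding definable_fun_def by simp
  then show ?thesis
    unfolding Ball_def using assms(2)
    by (intro definable_All definable_imp definable_mem definable_fun_var)
qed

lemma definable_Bex:
  assumes "definable_fun f" "definable (\<lambda>e. P (\<lambda>n. e (Suc n)) (e 0))"
  shows "definable (\<lambda>e. \<exists>x\<in>fin_set (f e). P e x)"
  using definable_not[OF definable_Ball[OF assms(1), of "\<lambda>e x. \<not> P e x"]]
    definable_not[OF assms(2)] by simp

lemmas definable_coding_intros =
  definable_fun_prod_encode definable_fun_fst definable_fun_snd definable_mem
  definable_Ball definable_Bex definable_intros

section \<open>Consistent collections of families of finite sets\<close>

text \<open>
  A relation \<open>Q\<close> carries two pieces of data: the tournament \<open>tour Q\<close>, read off the pairs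
  \<open>(x, y)\<close> with \<open>x < y\<close>, and a colouring of the numbers by two colours, read off the diagonal.
\<close>

definition tour :: "(nat \<times> nat) set \<Rightarrow> (nat \<times> nat) set" where
  "tour Q = {(x, y). x < y \<and> (x, y) \<in> Q \<or> y < x \<and> (y, x) \<notin> Q}"

definition trans_in :: "(nat \<times> nat) set \<Rightarrow> nat set \<Rightarrow> bool" where
  "trans_in Q A \<longleftrightarrow>
     (\<forall>x\<in>A. \<forall>y\<in>A. \<forall>w\<in>A. (x, y) \<in> tour Q \<longrightarrow> (y, w) \<in> tour Q \<longrightarrow> (x, w) \<in> tour Q)"

definition homog :: "(nat \<times> nat) set \<Rightarrow> nat set \<Rightarrow> bool" where
  "homog Q A \<longleftrightarrow> (\<forall>x\<in>A. \<forall>y\<in>A. (x, x) \<in> Q \<longleftrightarrow> (y, y) \<in> Q)"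

definition hits :: "(nat \<times> nat) set set \<Rightarrow> nat set set \<Rightarrow> nat set \<Rightarrow> bool" where
  "hits QQ S z \<longleftrightarrow> (\<exists>\<rho>\<in>S. \<rho> \<subseteq> z \<and> (\<forall>Q\<in>QQ. trans_in Q \<rho>))"

definition realizes :: "(nat \<times> nat) set set \<Rightarrow> nat set set set \<Rightarrow> nat set \<Rightarrow> bool" where
  "realizes QQ E z \<longleftrightarrow> finite z \<and> (\<forall>Q\<in>QQ. homog Q z) \<and> (\<forall>S\<in>E. hits QQ S z)"

definition consistent :: "nat set set set \<Rightarrow> bool" where
  "consistent D \<longleftrightarrow> (\<forall>QQ E. finite QQ \<longrightarrow> finite E \<longrightarrow> E \<subseteq> D \<longrightarrow> (\<exists>z. realizes QQ E z))"

lemma tour_total: "x \<noteq> y \<Longrightarrow> (x, y) \<in> tour Q \<longleftrightarrow> (y, x) \<notin> tour Q"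
  by (auto simp: tour_def)

lemma tour_tournament:
  assumes "tournament_on UNIV T"
  shows "tour T = T"
proof (rule set_eqI)
  fix p :: "nat \<times> nat"
  obtain x y where p: "p = (x, y)" by (cases p)
  have "(x, x) \<notin> T" "x \<noteq> y \<Longrightarrow> (x, y) \<in> T \<longleftrightarrow> (y, x) \<notin> T"
    using assms unfolding tournament_on_def irrefl_def by blast+
  then show "p \<in> tour T \<longleftrightarrow> p \<in> T"
    unfolding p tour_def by (cases x y rule: linorder_cases) simp_all
qed

lemma trans_in_singleton: "trans_in Q {x}"
  by (auto simp: trans_in_def)

text \<open>An ordered sum of two transitive tournaments is transitive; \<open>d\<close> says
  whether \<open>A\<close> comes before or after \<open>B\<close>.\<close>

lemma trans_in_Un:
  assumes "trans_in Q A" "trans_in Q B"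
    and dir: "\<And>x y. x \<in> A \<Longrightarrow> y \<in> B \<Longrightarrow> (x, y) \<in> tour Q \<longleftrightarrow> d" "\<And>x. x \<in> A \<Longrightarrow> x \<notin> B"
  shows "trans_in Q (A \<union> B)"
proof -
  have dir': "(y, x) \<in> tour Q \<longleftrightarrow> \<not> d" if "x \<in> A" "y \<in> B" for x y
    using dir that tour_total[of x y Q] by blast
  have A: "(x, w) \<in> tour Q" if "x \<in> A" "y \<in> A" "w \<in> A" "(x, y) \<in> tour Q" "(y, w) \<in> tour Q" for x y w
    using assms(1) that unfolding trans_in_def by blast
  have B: "(x, w) \<in> tour Q" if "x \<in> B" "y \<in> B" "w \<in> B" "(x, y) \<in> tour Q" "(y, w) \<in> tour Q" for x y w
    using assms(2) that unfolding trans_in_def by blast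
  show ?thesis
    unfolding trans_in_def
    by (intro ballI impI, elim UnE) (auto simp: dir(1) dir' dest: A B)
qed

lemma hits_mono: "hits QQ S z \<Longrightarrow> QQ' \<subseteq> QQ \<Longrightarrow> z \<subseteq> z' \<Longrightarrow> hits QQ' S z'"
  unfolding hits_def by (elim bexE, intro bexI) auto

lemma realizes_mono: "realizes QQ E z \<Longrightarrow> QQ' \<subseteq> QQ \<Longrightarrow> E' \<subseteq> E \<Longrightarrow> realizes QQ' E' z"
  unfolding realizes_def by (auto elim: hits_mono)

lemma consistent_mono: "consistent D \<Longrightarrow> D' \<subseteq> D \<Longrightarrow> consistent D'"
  unfolding consistent_def by blast

lemma consistent_UN:
  fixes D :: "nat \<Rightarrow> nat set set set"
  assumes "\<And>n. D n \<subseteq> D (Suc n)" "\<And>n. consistent (D n)"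
  shows "consistent (\<Union>n. D n)"
  unfolding consistent_def
proof (intro allI impI)
  fix QQ :: "(nat \<times> nat) set set" and E :: "nat set set set"
  assume QQ: "finite QQ" and E: "finite E" "E \<subseteq> (\<Union>n. D n)"
  have mono: "m \<le> n \<Longrightarrow> D m \<subseteq> D n" for m n
    by (rule lift_Suc_mono_le) (rule assms(1))
  from E have "\<exists>n. E \<subseteq> D n"
  proof (induction E rule: finite_induct)
    case (insert S E)
    then obtain m n where "E \<subseteq> D m" "S \<in> D n" by blast
    then have "insert S E \<subseteq> D (max m n)"
      using mono[of m "max m n"] mono[of n "max m n"] by auto
    then show ?case by blast
  qed simp
  then show "\<exists>z. realizes QQ E z" using assms(2) QQ E(1) unfolding consistent_def by blast
qed

text \<open>These families start the construction of \<open>D\<close>; they make the ultrafilter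
  free and the generic set infinite.\<close>

definition beyond :: "nat \<Rightarrow> nat set set" where
  "beyond m = {\<rho>. finite \<rho> \<and> (\<exists>x\<in>\<rho>. m \<le> x)}"

text \<open>A singleton is homogeneous and transitive for everything, so one large number meets all
  demands at once.\<close>

lemma consistent_beyond: "consistent (range beyond)"
  unfolding consistent_def
proof (intro allI impI)
  fix QQ :: "(nat \<times> nat) set set" and E :: "nat set set set"
  assume "finite E" "E \<subseteq> range beyond"
  then obtain M where M: "finite M" "E = beyond ` M" by (metis finite_subset_image)
  then obtain b where "\<And>m. m \<in> M \<Longrightarrow> m \<le> b" by (metis finite_nat_set_iff_bounded_le)
  then have "realizes QQ E {b}"
    using M(2) by (auto simp: realizes_def hits_def homog_def beyond_def trans_in_singleton intro!: exI[of _ "{b}"])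
  then show "\<exists>z. realizes QQ E z" by blast
qed

subsection \<open>Ultrafilters\<close>

definition has_fip :: "'a set set \<Rightarrow> bool" where
  "has_fip U \<longleftrightarrow> (\<forall>F. finite F \<longrightarrow> F \<subseteq> U \<longrightarrow> \<Inter>F \<noteq> {})"

text \<open>Closure under supersets and finite intersections follows from these two clauses, see
  \<open>ultra_superset_Inter\<close>.\<close>

definition ultra :: "'a set set \<Rightarrow> bool" where
  "ultra U \<longleftrightarrow> has_fip U \<and> (\<forall>X. X \<in> U \<or> - X \<in> U)"

lemma ultra_exists:
  assumes "has_fip F"
  shows "\<exists>U. F \<subseteq> U \<and> ultra U"
proof -
  let ?P = "{U. F \<subseteq> U \<and> has_fip U}"
  have "\<exists>M\<in>?P. \<forall>X\<in>?P. M \<subseteq> X \<longrightarrow> X = M"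
  proof (rule subset_Zorn_nonempty)
    show "?P \<noteq> {}" using assms by blast
  next
    fix C assume C: "C \<noteq> {}" "subset.chain ?P C"
    have "has_fip (\<Union>C)"
      unfolding has_fip_def
    proof (intro allI impI)
      fix G :: "'a set set" assume "finite G" "G \<subseteq> \<Union>C"
      then obtain U where "U \<in> C" "G \<subseteq> U"
        using finite_subset_Union_chain[of G C ?P] C by blast
      then show "\<Inter>G \<noteq> {}"
        using C(2) \<open>finite G\<close> unfolding subset_chain_def has_fip_def by blast
    qed
    then show "\<Union>C \<in> ?P" using C unfolding subset_chain_def by blast
  qed
  then obtain M where "M \<in> ?P" and "\<forall>X\<in>?P. M \<subseteq> X \<longrightarrow> X = M" by (elim bexE)
  then have M: "F \<subseteq> M" "has_fip M" and max: "\<And>X. F \<subseteq> X \<Longrightarrow> has_fip X \<Longrightarrow> M \<subseteq> X \<Longrightarrow> X = M"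
    by simp_all
  have "X \<in> M \<or> - X \<in> M" for X
  proof (rule ccontr)
    assume "\<not> ?thesis"
    then have n: "\<not> has_fip (insert X M)" "\<not> has_fip (insert (- X) M)"
      using max[of "insert X M"] max[of "insert (- X) M"] M(1) by (metis insert_iff subset_insertI2 subset_insertI)+
    \<comment> \<open>If adding \<open>Y\<close> destroys the intersection property, finitely many
      members of \<open>M\<close> have an intersection that misses \<open>Y\<close>. Using this for
      \<open>X\<close> and for \<open>- X\<close> contradicts the property for
      \<open>M\<close>.\<close>
    have *: "\<exists>G. finite G \<and> G \<subseteq> M \<and> \<Inter>G \<inter> Y = {}" if nf: "\<not> has_fip (insert Y M)" for Y
    proof -
      from nf obtain F' where F': "finite F'" "F' \<subseteq> insert Y M" "\<Inter>F' = {}"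
        unfolding has_fip_def by blast
      have "\<Inter>(F' - {Y}) \<inter> Y \<subseteq> \<Inter>F'" by blast
      then show ?thesis using F' by (intro exI[of _ "F' - {Y}"]) auto
    qed
    obtain G1 G2 where G: "finite G1" "G1 \<subseteq> M" "finite G2" "G2 \<subseteq> M"
      and "\<Inter>G1 \<inter> X = {}" "\<Inter>G2 \<inter> - X = {}"
      using *[OF n(1)] *[OF n(2)] by blast
    moreover have "\<Inter>(G1 \<union> G2) \<subseteq> (\<Inter>G1 \<inter> X) \<union> (\<Inter>G2 \<inter> - X)" by blast
    ultimately have "\<Inter>(G1 \<union> G2) = {}" by simp
    moreover have "finite (G1 \<union> G2)" "G1 \<union> G2 \<subseteq> M" using G by simp_all
    ultimately have False if "has_fip M" using that unfolding has_fip_def by blast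
    with M(2) show False by blast
  qed
  with M show ?thesis unfolding ultra_def by blast
qed

lemma ultra_nonempty: "ultra U \<Longrightarrow> X \<in> U \<Longrightarrow> X \<noteq> {}"
  unfolding ultra_def has_fip_def by (metis Inter_insert Inter_empty Int_UNIV_right empty_subsetI finite.emptyI finite_insert insert_subset)

lemma ultra_compl_iff: "ultra U \<Longrightarrow> - X \<in> U \<longleftrightarrow> X \<notin> U"
proof
  assume U: "ultra U" and "- X \<in> U"
  show "X \<notin> U"
  proof
    assume "X \<in> U"
    with U \<open>- X \<in> U\<close> have "\<Inter>{X, - X} \<noteq> {}"
      unfolding ultra_def has_fip_def by (metis empty_subsetI finite.emptyI finite_insert insert_subset)
    then show False by simp
  qed
qed (auto simp: ultra_def)

lemma ultra_superset_Inter: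
  assumes U: "ultra U" and F: "finite F" "F \<subseteq> U" "\<Inter>F \<subseteq> Y"
  shows "Y \<in> U"
proof (rule ccontr)
  assume "Y \<notin> U"
  then have "finite (insert (- Y) F)" "insert (- Y) F \<subseteq> U" using U F by (auto simp: ultra_def)
  then have "\<Inter>(insert (- Y) F) \<noteq> {}" using U unfolding ultra_def has_fip_def by blast
  then show False using F(3) by auto
qed

lemma ultra_UNIV: "ultra U \<Longrightarrow> UNIV \<in> U"
  using ultra_superset_Inter[of U "{}"] by auto

lemma ultra_superset: "ultra U \<Longrightarrow> X \<in> U \<Longrightarrow> X \<subseteq> Y \<Longrightarrow> Y \<in> U"
  using ultra_superset_Inter[of U "{X}"] by auto

lemma ultra_Int: "ultra U \<Longrightarrow> X \<in> U \<Longrightarrow> Y \<in> U \<Longrightarrow> X \<inter> Y \<in> U"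
  using ultra_superset_Inter[of U "{X, Y}"] by auto

lemma ultra_INT:
  "ultra U \<Longrightarrow> finite I \<Longrightarrow> (\<And>i. i \<in> I \<Longrightarrow> X i \<in> U) \<Longrightarrow> (\<Inter>i\<in>I. X i) \<in> U"
  using ultra_superset_Inter[of U "X ` I"] by auto

lemma free_ultra_exists: "\<exists>U :: nat set set. ultra U \<and> (\<forall>n. {n..} \<in> U)"
proof -
  have "has_fip (range (\<lambda>n::nat. {n..}))"
    unfolding has_fip_def
  proof (intro allI impI)
    fix F :: "nat set set" assume "finite F" "F \<subseteq> range (\<lambda>n. {n..})"
    then obtain M where M: "finite M" "F = (\<lambda>n. {n..}) ` M" by (metis finite_subset_image)
    then obtain b where "\<And>m. m \<in> M \<Longrightarrow> m \<le> b" by (metis finite_nat_set_iff_bounded_le)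
    then have "b \<in> \<Inter>F" using M(2) by auto
    then show "\<Inter>F \<noteq> {}" by blast
  qed
  from ultra_exists[OF this] show ?thesis by blast
qed

subsection \<open>Consistency of finite collections is arithmetical\<close>

text \<open>One set of numbers stands for a sequence of relations; compactness can then be argued
  for sets of numbers, and \<open>fin_set\<close> codes apply.\<close>

definition rel_of :: "nat set \<Rightarrow> nat \<Rightarrow> (nat \<times> nat) set" where
  "rel_of P j = {(x, y). prod_encode (j, prod_encode (x, y)) \<in> P}"

lemma homog_cong:
  "(\<And>x. x \<in> z \<Longrightarrow> (x, x) \<in> Q \<longleftrightarrow> (x, x) \<in> Q') \<Longrightarrow> homog Q z \<longleftrightarrow> homog Q' z"
  unfolding homog_def by blast

lemma trans_in_cong:
  assumes "\<And>x y. x \<in> z \<Longrightarrow> y \<in> z \<Longrightarrow> (x, y) \<in> Q \<longleftrightarrow> (x, y) \<in> Q'"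
  shows "trans_in Q z \<longleftrightarrow> trans_in Q' z"
proof -
  have "(x, y) \<in> tour Q \<longleftrightarrow> (x, y) \<in> tour Q'" if "x \<in> z" "y \<in> z" for x y
    using assms that by (auto simp: tour_def)
  then show ?thesis unfolding trans_in_def by blast
qed

lemma realizes_rel_of_cong:
  assumes "\<And>j x y. j < k \<Longrightarrow> x \<in> z \<Longrightarrow> y \<in> z \<Longrightarrow> (x, y) \<in> rel_of P j \<longleftrightarrow> (x, y) \<in> rel_of P' j"
    and "realizes (rel_of P ` {..<k}) E z"
  shows "realizes (rel_of P' ` {..<k}) E z"
proof -
  have h: "homog (rel_of P' j) z" if "j < k" for j
    using assms that homog_cong[of z "rel_of P j" "rel_of P' j"] by (auto simp: realizes_def)
  have t: "hits (rel_of P' ` {..<k}) S z" if "S \<in> E" for S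
  proof -
    obtain \<rho> where \<rho>: "\<rho> \<in> S" "\<rho> \<subseteq> z" "\<forall>j<k. trans_in (rel_of P j) \<rho>"
      using assms(2) \<open>S \<in> E\<close> by (auto simp: realizes_def hits_def)
    have "trans_in (rel_of P' j) \<rho>" if "j < k" for j
      using \<rho> that assms(1) trans_in_cong[of \<rho> "rel_of P j" "rel_of P' j"] by blast
    with \<rho> show ?thesis by (auto simp: hits_def)
  qed
  show ?thesis using h t assms(2) by (auto simp: realizes_def)
qed

text \<open>Compactness of the space of all \<open>P\<close>, by passing to an ultralimit of counterexamples.\<close>

lemma realizes_compact:
  assumes ex: "\<And>P. \<exists>z. realizes (rel_of P ` {..<k}) E z"
  shows "\<exists>N. \<forall>P. \<exists>z\<subseteq>{..<N}. realizes (rel_of P ` {..<k}) E z"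
proof (rule ccontr)
  assume "\<not> ?thesis"
  then obtain P where P: "\<And>N z. z \<subseteq> {..<N} \<Longrightarrow> \<not> realizes (rel_of (P N) ` {..<k}) E z" by metis
  obtain U :: "nat set set" where U: "ultra U" "\<And>n. {n..} \<in> U" using free_ultra_exists by blast
  \<comment> \<open>The ultralimit of the counterexamples \<open>P N\<close>.\<close>
  define L where "L = {m. {N. m \<in> P N} \<in> U}"
  obtain z where z: "realizes (rel_of L ` {..<k}) E z" using ex by blast
  then have "finite z" by (simp add: realizes_def)
  then obtain M where M: "z \<subseteq> {..<M}"
    unfolding finite_nat_set_iff_bounded by auto
  let ?I = "(\<lambda>(j, x, y). prod_encode (j, prod_encode (x, y))) ` ({..<k} \<times> z \<times> z)"
  have fin: "finite ?I" using \<open>finite z\<close> by simp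
  have "{N. m \<in> P N \<longleftrightarrow> m \<in> L} \<in> U" for m
  proof (cases "m \<in> L")
    case False
    then have "- {N. m \<in> P N} \<in> U" using U(1) by (simp add: L_def ultra_compl_iff)
    then show ?thesis using False by (simp add: Compl_eq)
  qed (simp add: L_def)
  \<comment> \<open>Whether \<open>z\<close> is a realizer depends only on the finitely many
    membership questions in \<open>?I\<close>. For \<open>U\<close>-almost all \<open>N\<close> they
    have the same answers for \<open>P N\<close> and \<open>L\<close>, and \<open>N \<ge> M\<close>
    puts \<open>z\<close> below \<open>N\<close>.\<close>
  then have "(\<Inter>m\<in>?I. {N. m \<in> P N \<longleftrightarrow> m \<in> L}) \<inter> {M..} \<in> U"
    using U fin by (intro ultra_Int ultra_INT) auto
  then obtain N where N: "N \<in> (\<Inter>m\<in>?I. {N. m \<in> P N \<longleftrightarrow> m \<in> L}) \<inter> {M..}"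
    using ultra_nonempty[OF U(1)] by blast
  have "realizes (rel_of (P N) ` {..<k}) E z"
    using z by (rule realizes_rel_of_cong[rotated]) (use N in \<open>force simp: rel_of_def\<close>)
  moreover have "z \<subseteq> {..<N}" using M N by auto
  ultimately show False using P by blast
qed

lemma rel_of_surj:
  assumes "finite QQ"
  shows "\<exists>P k. rel_of P ` {..<k} = QQ"
proof -
  obtain f :: "nat \<Rightarrow> (nat \<times> nat) set" and k where f: "QQ = f ` {i. i < k}"
    using finite_imp_nat_seg_image_inj_on[OF assms] by blast
  define P where "P = {prod_encode (j, prod_encode (x, y)) | j x y. (x, y) \<in> f j}"
  have "rel_of P j = f j" for j by (auto simp: rel_of_def P_def)
  then show ?thesis using f by (intro exI[of _ P] exI[of _ k]) (auto simp: lessThan_def)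
qed

text \<open>For finite \<open>D\<close> the case \<open>E = D\<close> is the hardest. Compactness
  bounds the realizers by some \<open>N\<close>; below \<open>N\<close> only a finite part of the
  relations matters, so finite codes suffice.\<close>

lemma consistent_iff_finitary:
  assumes "finite D"
  shows "consistent D \<longleftrightarrow>
    (\<forall>k. \<exists>N. \<forall>c. \<exists>z. (\<forall>x\<in>fin_set z. x < N) \<and> realizes (rel_of (fin_set c) ` {..<k}) D (fin_set z))"
    (is "_ \<longleftrightarrow> ?R")
proof
  assume c: "consistent D"
  show ?R
  proof
    fix k
    have "\<exists>z. realizes (rel_of P ` {..<k}) D z" for P
      using c assms unfolding consistent_def by blast
    from realizes_compact[OF this]
    obtain N where N: "\<forall>P. \<exists>z\<subseteq>{..<N}. realizes (rel_of P ` {..<k}) D z" ..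
    have "\<exists>z. (\<forall>x\<in>fin_set z. x < N) \<and> realizes (rel_of (fin_set c) ` {..<k}) D (fin_set z)" for c
    proof -
      from N[rule_format, of "fin_set c"]
      obtain A where A: "A \<subseteq> {..<N}" "realizes (rel_of (fin_set c) ` {..<k}) D A" by (elim exE conjE)
      then have "finite A" by (simp add: realizes_def)
      from fin_set_surj[OF this] obtain z where "fin_set z = A" ..
      then show ?thesis using A by (intro exI[of _ z]) auto
    qed
    then show "\<exists>N. \<forall>c. \<exists>z. (\<forall>x\<in>fin_set z. x < N) \<and> realizes (rel_of (fin_set c) ` {..<k}) D (fin_set z)"
      by iprover
  qed
next
  assume R: ?R
  show "consistent D"
    unfolding consistent_def
  proof (intro allI impI)
    fix QQ :: "(nat \<times> nat) set set" and E :: "nat set set set"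
    assume "finite QQ" and E: "E \<subseteq> D"
    then obtain P k where P: "QQ = rel_of P ` {..<k}" using rel_of_surj by metis
    from R[rule_format, of k]
    obtain N where N: "\<forall>c. \<exists>z. (\<forall>x\<in>fin_set z. x < N) \<and> realizes (rel_of (fin_set c) ` {..<k}) D (fin_set z)" ..
    let ?I = "(\<lambda>(j, x, y). prod_encode (j, prod_encode (x, y))) ` ({..<k} \<times> {..<N} \<times> {..<N})"
    obtain c where c: "fin_set c = P \<inter> ?I" using fin_set_surj[of "P \<inter> ?I"] by auto
    from N[rule_format, of c]
    obtain z where z: "\<forall>x\<in>fin_set z. x < N" "realizes (rel_of (P \<inter> ?I) ` {..<k}) D (fin_set z)"
      unfolding c by (elim exE conjE)
    from z(2) have "realizes (rel_of P ` {..<k}) D (fin_set z)"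
      by (rule realizes_rel_of_cong[rotated]) (use z(1) in \<open>force simp: rel_of_def\<close>)
    then have "realizes QQ E (fin_set z)" unfolding P using E by (rule realizes_mono[OF _ order_refl])
    then show "\<exists>z. realizes QQ E z" ..
  qed
qed

text \<open>The families are arithmetical uniformly in their index; since all members are finite,
  codes describe the families completely.\<close>

definition arith_seq :: "(nat \<Rightarrow> nat set set) \<Rightarrow> bool" where
  "arith_seq F \<longleftrightarrow> (\<forall>i. \<forall>\<rho>\<in>F i. finite \<rho>) \<and> definable (\<lambda>e. fin_set (e (Suc 0)) \<in> F (e 0))"

lemma definable_in_seq:
  "arith_seq F \<Longrightarrow> definable_fun f \<Longrightarrow> definable_fun g \<Longrightarrow> definable (\<lambda>e. fin_set (g e) \<in> F (f e))"
  unfolding arith_seq_def by (rule definable_app2[where Q = "\<lambda>i c. fin_set c \<in> F i"]) auto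

lemma definable_rel_of:
  "definable_fun f \<Longrightarrow> definable_fun g \<Longrightarrow> definable_fun h \<Longrightarrow> definable_fun l \<Longrightarrow>
     definable (\<lambda>e. (f e, g e) \<in> rel_of (fin_set (h e)) (l e))"
  unfolding rel_of_def by (simp only: mem_Collect_eq split) (intro definable_coding_intros)

lemma definable_trans_in: "definable (\<lambda>e. trans_in (rel_of (fin_set (e i)) (e j)) (fin_set (e l)))"
  unfolding trans_in_def tour_def mem_Collect_eq split
  by (intro definable_rel_of definable_coding_intros)

lemma definable_homog: "definable (\<lambda>e. homog (rel_of (fin_set (e i)) (e j)) (fin_set (e l)))"
  unfolding homog_def by (intro definable_rel_of definable_coding_intros)

text \<open>In the finitary form every quantifier ranges over numbers: the member of a family found
  inside a finite set is itself finite and has a code.\<close>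

lemma definable_consistent:
  assumes F: "arith_seq F"
  shows "definable (\<lambda>e. consistent (F ` fin_set (e i)))"
proof -
  have eq: "realizes (rel_of (fin_set c) ` {..<k}) (F ` fin_set s) (fin_set z) \<longleftrightarrow>
    (\<forall>j. j < k \<longrightarrow> homog (rel_of (fin_set c) j) (fin_set z)) \<and>
    (\<forall>i\<in>fin_set s. \<exists>r. fin_set r \<in> F i \<and> (\<forall>x\<in>fin_set r. x \<in> fin_set z) \<and>
       (\<forall>j. j < k \<longrightarrow> trans_in (rel_of (fin_set c) j) (fin_set r)))" (is "?L \<longleftrightarrow> ?R") for c k s z
  proof -
    have "hits (rel_of (fin_set c) ` {..<k}) (F i) (fin_set z) \<longleftrightarrow>
      (\<exists>r. fin_set r \<in> F i \<and> (\<forall>x\<in>fin_set r. x \<in> fin_set z) \<and>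
       (\<forall>j. j < k \<longrightarrow> trans_in (rel_of (fin_set c) j) (fin_set r)))" (is "?A \<longleftrightarrow> ?B") for i
    proof
      assume ?A
      then obtain \<rho> where \<rho>: "\<rho> \<in> F i" "\<rho> \<subseteq> fin_set z" "\<forall>Q\<in>rel_of (fin_set c) ` {..<k}. trans_in Q \<rho>"
        unfolding hits_def by (elim bexE conjE)
      obtain r where r: "fin_set r = \<rho>" using fin_set_surj[OF finite_subset[OF \<rho>(2) finite_fin_set]] ..
      show ?B using \<rho> unfolding r[symmetric] by (intro exI[of _ r]) auto
    next
      assume ?B
      then obtain r where "fin_set r \<in> F i" "\<forall>x\<in>fin_set r. x \<in> fin_set z"
        "\<forall>j. j < k \<longrightarrow> trans_in (rel_of (fin_set c) j) (fin_set r)" by (elim exE conjE)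
      then show ?A unfolding hits_def by (intro bexI[of _ "fin_set r"]) auto
    qed
    then show ?thesis unfolding realizes_def by (simp add: Ball_def[of "{..<k}"])
  qed
  show ?thesis
    unfolding consistent_iff_finitary[OF finite_imageI[OF finite_fin_set]] eq
    by (intro definable_in_seq[OF F] definable_trans_in definable_homog definable_coding_intros)
qed

section \<open>Formulas in a reduced syntax\<close>

text \<open>
  An environment that vanishes almost everywhere is coded by one number, so that forcing a formula
  becomes a relation between numbers and finite sets.
\<close>

primrec env :: "nat \<Rightarrow> nat \<Rightarrow> nat" where
  "env i 0 = fst (prod_decode i)"
| "env i (Suc n) = env (snd (prod_decode i)) n"

lemma env_prod_encode [simp]: "env (prod_encode (a, i)) = case_nat a (env i)"
proof
  fix n show "env (prod_encode (a, i)) n = case_nat a (env i) n"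
    by (cases n) auto
qed

lemma env_0 [simp]: "env 0 = (\<lambda>_. 0)"
proof
  fix n
  have "prod_decode 0 = (0, 0)"
    using prod_encode_inverse[of "(0, 0)"] by (simp add: prod_encode_def)
  then show "env 0 n = 0" by (induction n) auto
qed

text \<open>Few connectives keep the forcing clauses few. The translation from \<open>fm\<close> has
  to preserve truth only, not the level in the hierarchy.\<close>

datatype form =
    FLess tm tm
  | FOracle tm
  | FNeg form
  | FConj form form
  | FEx form

instance tm :: countable by countable_datatype
instance form :: countable by countable_datatype

primrec fsat :: "nat set \<Rightarrow> form \<Rightarrow> nat \<Rightarrow> bool" where
  "fsat X (FLess s t) i \<longleftrightarrow> val (env i) s < val (env i) t"
| "fsat X (FOracle t) i \<longleftrightarrow> val (env i) t \<in> X"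
| "fsat X (FNeg p) i \<longleftrightarrow> \<not> fsat X p i"
| "fsat X (FConj p q) i \<longleftrightarrow> fsat X p i \<and> fsat X q i"
| "fsat X (FEx p) i \<longleftrightarrow> (\<exists>a. fsat X p (prod_encode (a, i)))"

primrec form_of :: "fm \<Rightarrow> form" where
  "form_of (Eq s t) = FConj (FNeg (FLess s t)) (FNeg (FLess t s))"
| "form_of (Less s t) = FLess s t"
| "form_of (Oracle t) = FOracle t"
| "form_of (Neg p) = FNeg (form_of p)"
| "form_of (Conj p q) = FConj (form_of p) (form_of q)"
| "form_of (Disj p q) = FNeg (FConj (FNeg (form_of p)) (FNeg (form_of q)))"
| "form_of (BAll t p) =
     FNeg (FEx (FConj (FLess (Var 0) (rename_tm Suc t)) (FNeg (form_of p))))"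
| "form_of (BEx t p) = FEx (FConj (FLess (Var 0) (rename_tm Suc t)) (form_of p))"
| "form_of (All p) = FNeg (FEx (FNeg (form_of p)))"
| "form_of (Ex p) = FEx (form_of p)"

lemma fsat_form_of [simp]: "fsat X (form_of p) i \<longleftrightarrow> sat X (env i) p"
  by (induction p arbitrary: i) auto

lemma definable_fun_env: "definable_fun f \<Longrightarrow> definable_fun (\<lambda>e. env (f e) j)"
  by (induction j arbitrary: f) (auto intro: definable_fun_fst definable_fun_snd)

lemma definable_fun_val: "definable_fun f \<Longrightarrow> definable_fun (\<lambda>e. val (env (f e)) t)"
  by (induction t) (auto intro: definable_fun_env definable_intros)

section \<open>Deciding a sequence of families greedily\<close>

primrec greedy :: "(nat set \<Rightarrow> bool) \<Rightarrow> nat \<Rightarrow> nat set" where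
  "greedy C 0 = {}"
| "greedy C (Suc n) = (if C (insert n (greedy C n)) then insert n (greedy C n) else greedy C n)"

definition selected :: "(nat set \<Rightarrow> bool) \<Rightarrow> nat set" where
  "selected C = {i. C (insert i (greedy C i))}"

lemma greedy_eq: "greedy C n = {i \<in> selected C. i < n}"
proof (induction n)
  case (Suc n)
  have "C (insert n (greedy C n)) \<longleftrightarrow> n \<in> selected C" by (simp add: selected_def)
  with Suc show ?case by (auto simp: less_Suc_eq)
qed simp

lemma greedy_invariant: "C {} \<Longrightarrow> C (greedy C n)"
  by (induction n) auto

text \<open>A finite set \<open>c\<close> records a run of the greedy procedure: if it takes the
  right decision at each \<open>j \<le> i\<close> relative to its own earlier decisions, it agrees
  with \<open>selected C\<close> up to \<open>i\<close>.\<close>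

lemma definable_selected:
  assumes C: "definable (\<lambda>e. C (fin_set (e 0)))"
  shows "definable (\<lambda>e. e i \<in> selected C)"
proof -
  let ?ok = "\<lambda>A j. j \<in> A \<longleftrightarrow> C (insert j {x \<in> A. x < j})"
  have ok_selected: "?ok (selected C) j" for j
    unfolding greedy_eq[symmetric] by (simp add: selected_def)
  have eq: "i \<in> selected C \<longleftrightarrow> (\<exists>c. i \<in> fin_set c \<and> (\<forall>j. j < Suc i \<longrightarrow>
      (j \<in> fin_set c \<longleftrightarrow> (\<exists>d. (\<forall>x. x \<in> fin_set d \<longleftrightarrow> x = j \<or> x \<in> fin_set c \<and> x < j) \<and> C (fin_set d)))))"
    (is "_ \<longleftrightarrow> ?R") for i
  proof -
    \<comment> \<open>\<open>C\<close> is only known to be definable on codes, so the set tested at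
      \<open>j\<close> is named by a code \<open>d\<close>.\<close>
    have d: "(\<exists>d. (\<forall>x. x \<in> fin_set d \<longleftrightarrow> x = j \<or> x \<in> fin_set c \<and> x < j) \<and> C (fin_set d)) \<longleftrightarrow>
        C (insert j {x \<in> fin_set c. x < j})" (is "?A \<longleftrightarrow> ?B") for c j
    proof
      assume ?A
      then obtain d where d: "\<forall>x. x \<in> fin_set d \<longleftrightarrow> x = j \<or> x \<in> fin_set c \<and> x < j" "C (fin_set d)"
        by (elim exE conjE)
      then have "fin_set d = insert j {x \<in> fin_set c. x < j}" by auto
      with d(2) show ?B by simp
    next
      assume ?B
      have "finite (insert j {x \<in> fin_set c. x < j})" by simp
      from fin_set_surj[OF this] obtain d where "fin_set d = insert j {x \<in> fin_set c. x < j}" ..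
      with \<open>?B\<close> show ?A by (intro exI[of _ d]) auto
    qed
    show ?thesis
      unfolding d
    proof
      assume i: "i \<in> selected C"
      have "finite {j \<in> selected C. j < Suc i}" by simp
      from fin_set_surj[OF this] obtain c where c: "fin_set c = {j \<in> selected C. j < Suc i}" ..
      have "?ok (fin_set c) j" if "j < Suc i" for j
      proof -
        have "j \<in> fin_set c \<longleftrightarrow> j \<in> selected C" using that unfolding c by blast
        moreover have "{x \<in> fin_set c. x < j} = {x \<in> selected C. x < j}" using that unfolding c by auto
        ultimately show ?thesis using ok_selected[of j] by metis
      qed
      then show "\<exists>c. i \<in> fin_set c \<and> (\<forall>j<Suc i. ?ok (fin_set c) j)"
        using i c by (intro exI[of _ c] conjI allI impI) simp
    next
      assume "\<exists>c. i \<in> fin_set c \<and> (\<forall>j<Suc i. ?ok (fin_set c) j)"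
      then obtain c where "i \<in> fin_set c \<and> (\<forall>j<Suc i. ?ok (fin_set c) j)" ..
      then have c: "i \<in> fin_set c" "\<And>j. j < Suc i \<Longrightarrow> ?ok (fin_set c) j" by simp_all
      have "j \<in> fin_set c \<longleftrightarrow> j \<in> selected C" if "j < Suc i" for j
        using that
      proof (induction j rule: less_induct)
        case (less j)
        then have "{x \<in> fin_set c. x < j} = {x \<in> selected C. x < j}" by auto
        then show ?case using c(2)[OF less.prems] ok_selected[of j] by metis
      qed
      then show "i \<in> selected C" using c(1) by blast
    qed
  qed
  show ?thesis
    unfolding eq
    by (intro definable_app[where Q = "\<lambda>d. C (fin_set d)", OF C] definable_coding_intros)
qed

definition merge :: "(nat \<Rightarrow> nat set set) \<Rightarrow> (nat \<Rightarrow> nat set set) \<Rightarrow> nat \<Rightarrow> nat set set" where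
  "merge F G v = (if fst (prod_decode v) = 0 then F (snd (prod_decode v)) else G (snd (prod_decode v)))"

lemma merge_prod_encode [simp]:
  "merge F G (prod_encode (0, i)) = F i" "merge F G (prod_encode (Suc j, i)) = G i"
  by (simp_all add: merge_def)

lemma range_merge: "range (merge F G) = range F \<union> range G"
proof
  show "range F \<union> range G \<subseteq> range (merge F G)"
    using merge_prod_encode by (metis Un_least image_subsetI rangeI)
qed (auto simp: merge_def)

lemma arith_seq_merge:
  assumes F: "arith_seq F" and G: "arith_seq G"
  shows "arith_seq (merge F G)"
proof -
  have eq: "A \<in> merge F G v \<longleftrightarrow>
      fst (prod_decode v) = 0 \<and> A \<in> F (snd (prod_decode v)) \<or>
      \<not> fst (prod_decode v) = 0 \<and> A \<in> G (snd (prod_decode v))" for A v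
    by (simp add: merge_def)
  have "definable (\<lambda>e. fin_set (e (Suc 0)) \<in> merge F G (e 0))"
    unfolding eq by (intro definable_in_seq[OF F] definable_in_seq[OF G] definable_coding_intros)
  then show ?thesis using assms by (auto simp: arith_seq_def merge_def)
qed

text \<open>The possibly infinite \<open>range F\<close> is tested through its initial segments,
  which suffices by \<open>consistent_UN\<close>; each segment together with the \<open>G\<close>
  part is a finite piece of \<open>merge F G\<close>.\<close>

lemma definable_consistent_Un:
  assumes F: "arith_seq F" and G: "arith_seq G"
  shows "definable (\<lambda>e. consistent (range F \<union> G ` fin_set (e i)))"
proof -
  let ?D = "\<lambda>c n. F ` {..<n} \<union> G ` fin_set c"
  let ?ix = "\<lambda>c n. (\<lambda>x. prod_encode (0, x)) ` {..<n} \<union> (\<lambda>x. prod_encode (Suc 0, x)) ` fin_set c"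
  have ix: "merge F G ` ?ix c n = ?D c n" for c n
    by (simp add: image_Un image_image)
  have eq: "consistent (range F \<union> G ` fin_set c) \<longleftrightarrow> (\<forall>n d.
      (\<forall>v. v \<in> fin_set d \<longleftrightarrow>
        (\<exists>x. x < n \<and> v = prod_encode (0, x)) \<or> (\<exists>x\<in>fin_set c. v = prod_encode (Suc 0, x))) \<longrightarrow>
      consistent (merge F G ` fin_set d))" (is "?L \<longleftrightarrow> ?R") for c
  proof
    assume L: ?L
    show ?R
    proof (intro allI impI)
      fix n d
      assume "\<forall>v. v \<in> fin_set d \<longleftrightarrow>
        (\<exists>x. x < n \<and> v = prod_encode (0, x)) \<or> (\<exists>x\<in>fin_set c. v = prod_encode (Suc 0, x))"
      then have "fin_set d = ?ix c n" by auto
      then have "merge F G ` fin_set d = ?D c n" by (simp only: ix)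
      moreover have "?D c n \<subseteq> range F \<union> G ` fin_set c" by auto
      ultimately show "consistent (merge F G ` fin_set d)" using consistent_mono[OF L] by simp
    qed
  next
    assume R: ?R
    have "consistent (?D c n)" for n
    proof -
      have "finite (?ix c n)" by simp
      from fin_set_surj[OF this] obtain d where d: "fin_set d = ?ix c n" ..
      have "consistent (merge F G ` fin_set d)" using R[rule_format, of d n] d by auto
      then show ?thesis by (simp only: d ix)
    qed
    then have "consistent (\<Union>n. ?D c n)" by (intro consistent_UN) auto
    moreover have "(\<Union>n. ?D c n) = range F \<union> G ` fin_set c" by auto
    ultimately show ?L by simp
  qed
  show ?thesis
    unfolding eq
    by (intro definable_consistent[OF arith_seq_merge[OF F G]] definable_coding_intros)
qed

text \<open>Greedy decisions are final: an index outside \<open>I\<close> failed the test against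
  \<open>range F\<close> and earlier choices. All of these lie in every \<open>D\<close> above
  \<open>range H\<close>, so a consistent \<open>D\<close> cannot contain the rejected
  family.\<close>

lemma decide_seq:
  assumes F: "arith_seq F" and G: "arith_seq G" and con: "consistent (range F)"
  obtains H I where "arith_seq H" "range F \<subseteq> range H" "consistent (range H)"
    "definable (\<lambda>e. e 0 \<in> I)"
    "\<And>D i. range H \<subseteq> D \<Longrightarrow> consistent D \<Longrightarrow> G i \<in> D \<longleftrightarrow> i \<in> I"
proof -
  define C where "C = (\<lambda>s. consistent (range F \<union> G ` s))"
  define I where "I = selected C"
  \<comment> \<open>At rejected indices \<open>F 0\<close> is a filler that contributes no new
    family.\<close>
  define G' where "G' = (\<lambda>i. if i \<in> I then G i else F 0)"
  have defI: "definable (\<lambda>e. e i \<in> I)" for i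
    unfolding I_def C_def by (intro definable_selected definable_consistent_Un F G)
  have eq: "A \<in> G' i \<longleftrightarrow> i \<in> I \<and> A \<in> G i \<or> \<not> i \<in> I \<and> A \<in> F 0" for A i
    by (simp add: G'_def)
  have "definable (\<lambda>e. fin_set (e (Suc 0)) \<in> G' (e 0))"
    unfolding eq by (intro defI definable_in_seq[OF F] definable_in_seq[OF G] definable_coding_intros)
  then have G': "arith_seq G'" using F G by (auto simp: arith_seq_def G'_def)
  have range: "range (merge F G') = range F \<union> G ` I"
    unfolding range_merge by (auto simp: G'_def)
  have "C (greedy C n)" for n
    using con by (intro greedy_invariant[of C]) (simp add: C_def)
  then have "consistent (range F \<union> G ` greedy C n)" for n
    by (simp add: C_def)
  then have "consistent (\<Union>n. range F \<union> G ` greedy C n)"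
    by (rule consistent_UN[rotated]) auto
  moreover have "(\<Union>n. range F \<union> G ` greedy C n) = range F \<union> G ` I"
    unfolding greedy_eq I_def[symmetric] by auto
  ultimately have con': "consistent (range F \<union> G ` I)" by simp
  have "G i \<in> D \<longleftrightarrow> i \<in> I" if D: "range (merge F G') \<subseteq> D" "consistent D" for D i
  proof
    assume "G i \<in> D"
    then have "range F \<union> G ` insert i (greedy C i) \<subseteq> D"
      using D(1) unfolding range greedy_eq I_def[symmetric] by auto
    then show "i \<in> I" using consistent_mono[OF D(2)] by (simp add: I_def selected_def C_def)
  next
    assume "i \<in> I"
    then show "G i \<in> D" using D(1) range by auto
  qed
  with arith_seq_merge[OF F G'] con' defI show ?thesis
    by (intro that[of "merge F G'" I]) (auto simp: range)
qed

section \<open>Forcing\<close>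

text \<open>
  A finite set forces a negation if not every big family meets the set of extensions forcing the
  formula, where \<open>D\<close> collects the families that every big family has to meet.
\<close>

primrec force :: "nat set set set \<Rightarrow> form \<Rightarrow> nat \<Rightarrow> nat set \<Rightarrow> bool" where
  "force D (FLess s t) i \<sigma> \<longleftrightarrow> val (env i) s < val (env i) t"
| "force D (FOracle t) i \<sigma> \<longleftrightarrow> val (env i) t \<in> \<sigma>"
| "force D (FNeg p) i \<sigma> \<longleftrightarrow> {\<rho>. finite \<rho> \<and> force D p i (\<sigma> \<union> \<rho>)} \<notin> D"
| "force D (FConj p q) i \<sigma> \<longleftrightarrow> force D p i \<sigma> \<and> force D q i \<sigma>"
| "force D (FEx p) i \<sigma> \<longleftrightarrow> (\<exists>a. force D p (prod_encode (a, i)) \<sigma>)"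

text \<open>Absoluteness under consistent enlargement protects the decisions made for one formula
  while later formulas are treated.\<close>

definition settled :: "nat set set set \<Rightarrow> form \<Rightarrow> bool" where
  "settled D p \<longleftrightarrow>
     (\<forall>D'. D \<subseteq> D' \<longrightarrow> consistent D' \<longrightarrow> (\<forall>i \<sigma>. finite \<sigma> \<longrightarrow> (force D' p i \<sigma> \<longleftrightarrow> force D p i \<sigma>))) \<and>
     definable (\<lambda>e. force D p (e 0) (fin_set (e (Suc 0))))"

lemma settled_eq:
  "settled D p \<Longrightarrow> D \<subseteq> D' \<Longrightarrow> consistent D' \<Longrightarrow> finite \<sigma> \<Longrightarrow> force D' p i \<sigma> \<longleftrightarrow> force D p i \<sigma>"
  by (simp add: settled_def)

lemma definable_force:
  "settled D p \<Longrightarrow> definable_fun f \<Longrightarrow> definable_fun g \<Longrightarrow> definable (\<lambda>e. force D p (f e) (fin_set (g e)))"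
  unfolding settled_def by (rule definable_app2[where Q = "\<lambda>i c. force D p i (fin_set c)"]) auto

lemma settled_mono:
  assumes "settled D p" "D \<subseteq> D'" "consistent D'"
  shows "settled D' p"
proof -
  have eq: "force D'' p i \<sigma> \<longleftrightarrow> force D p i \<sigma>" if "D' \<subseteq> D''" "consistent D''" "finite \<sigma>" for D'' i \<sigma>
    using settled_eq[OF assms(1), of D''] that assms(2) by blast
  have "definable (\<lambda>e. force D' p (e 0) (fin_set (e (Suc 0))))"
    using assms(1) by (simp add: eq[OF order_refl assms(3)] settled_def)
  then show ?thesis using eq assms(3) by (simp add: settled_def)
qed

text \<open>Only negation requires new families. Once \<open>p\<close> is settled, the sets of
  extensions forcing \<open>p\<close> form an arithmetical sequence, and \<open>decide_seq\<close>
  fixes their membership in all consistent enlargements.\<close>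

lemma settle:
  assumes "arith_seq F" "consistent (range F)"
  shows "\<exists>H. arith_seq H \<and> range F \<subseteq> range H \<and> consistent (range H) \<and> settled (range H) p"
  using assms
proof (induction p arbitrary: F)
  case (FLess s t)
  have "definable (\<lambda>e. val (env (e 0)) s < val (env (e 0)) t)"
    by (intro definable_less definable_fun_val definable_fun_var)
  then have "settled (range F) (FLess s t)" by (simp add: settled_def)
  then show ?case using FLess by blast
next
  case (FOracle t)
  have "definable (\<lambda>e. val (env (e 0)) t \<in> fin_set (e (Suc 0)))"
    by (intro definable_mem definable_fun_val definable_fun_var)
  then have "settled (range F) (FOracle t)" by (simp add: settled_def)
  then show ?case using FOracle by blast
next
  case (FNeg p)
  then obtain F1 where F1: "arith_seq F1" "range F \<subseteq> range F1" "consistent (range F1)" "settled (range F1) p"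
    by blast
  \<comment> \<open>The index \<open>v\<close> codes an environment together with a finite set, so
    \<open>G\<close> lists all families occurring in the negation clause of \<open>force\<close> for
    \<open>p\<close>.\<close>
  define G where "G = (\<lambda>v. {\<rho>. finite \<rho> \<and>
    force (range F1) p (fst (prod_decode v)) (fin_set (snd (prod_decode v)) \<union> \<rho>)})"
  have eq: "fin_set c \<in> G v \<longleftrightarrow> (\<exists>u. (\<forall>x. x \<in> fin_set u \<longleftrightarrow>
      x \<in> fin_set (snd (prod_decode v)) \<or> x \<in> fin_set c) \<and>
      force (range F1) p (fst (prod_decode v)) (fin_set u))" (is "?L \<longleftrightarrow> ?R") for c v
  proof
    assume L: ?L
    have "finite (fin_set (snd (prod_decode v)) \<union> fin_set c)" by simp
    from fin_set_surj[OF this] obtain u where "fin_set u = fin_set (snd (prod_decode v)) \<union> fin_set c" ..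
    with L show ?R by (intro exI[of _ u]) (simp add: G_def)
  next
    assume ?R
    then obtain u where u: "\<forall>x. x \<in> fin_set u \<longleftrightarrow> x \<in> fin_set (snd (prod_decode v)) \<or> x \<in> fin_set c"
      "force (range F1) p (fst (prod_decode v)) (fin_set u)" by (elim exE conjE)
    then have "fin_set u = fin_set (snd (prod_decode v)) \<union> fin_set c" by auto
    with u(2) show ?L by (simp add: G_def)
  qed
  have "definable (\<lambda>e. fin_set (e (Suc 0)) \<in> G (e 0))"
    unfolding eq by (intro definable_force[OF F1(4)] definable_coding_intros)
  then have G: "arith_seq G" by (auto simp: arith_seq_def G_def)
  from decide_seq[OF F1(1) G F1(3)] obtain H I where
    H: "arith_seq H" "range F1 \<subseteq> range H" "consistent (range H)" and I: "definable (\<lambda>e. e 0 \<in> I)"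
    "\<And>D i. range H \<subseteq> D \<Longrightarrow> consistent D \<Longrightarrow> G i \<in> D \<longleftrightarrow> i \<in> I" by blast
  have key: "force D (FNeg p) i (fin_set c) \<longleftrightarrow> prod_encode (i, c) \<notin> I"
    if D: "range H \<subseteq> D" "consistent D" for D i c
  proof -
    have "{\<rho>. finite \<rho> \<and> force D p i (fin_set c \<union> \<rho>)} = G (prod_encode (i, c))"
      unfolding G_def using settled_eq[OF F1(4), of D] D H(2) by auto
    then show ?thesis using I(2)[OF D] by simp
  qed
  have "force D (FNeg p) i \<sigma> \<longleftrightarrow> force (range H) (FNeg p) i \<sigma>"
    if "range H \<subseteq> D" "consistent D" "finite \<sigma>" for D i \<sigma>
  proof -
    from fin_set_surj[OF that(3)] obtain c where "fin_set c = \<sigma>" ..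
    with key[OF that(1,2)] key[OF order_refl H(3)] show ?thesis by metis
  qed
  moreover have "definable (\<lambda>e. force (range H) (FNeg p) (e 0) (fin_set (e (Suc 0))))"
    unfolding key[OF order_refl H(3)]
    by (intro definable_app[where Q = "\<lambda>x. x \<in> I", OF I(1)] definable_coding_intros)
  ultimately have "settled (range H) (FNeg p)" unfolding settled_def by simp
  with H(1,3) subset_trans[OF F1(2) H(2)] show ?case by (intro exI[of _ H] conjI)
next
  case (FConj p q)
  from FConj.IH(1)[OF FConj.prems] obtain F1 where
    F1: "arith_seq F1" "range F \<subseteq> range F1" "consistent (range F1)" "settled (range F1) p" by blast
  from FConj.IH(2)[OF F1(1,3)] obtain H where
    H: "arith_seq H" "range F1 \<subseteq> range H" "consistent (range H)" "settled (range H) q" by blast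
  have p: "settled (range H) p" using settled_mono[OF F1(4) H(2,3)] .
  have "settled (range H) (FConj p q)"
    using p H(4) unfolding settled_def by (simp add: definable_conj)
  with H(1,3) subset_trans[OF F1(2) H(2)] show ?case by (intro exI[of _ H] conjI)
next
  case (FEx p)
  then obtain H where
    H: "arith_seq H" "range F \<subseteq> range H" "consistent (range H)" "settled (range H) p" by blast
  have "definable (\<lambda>e. force (range H) (FEx p) (e 0) (fin_set (e (Suc 0))))"
    unfolding force.simps by (intro definable_force[OF H(4)] definable_coding_intros)
  then have "settled (range H) (FEx p)"
    using H(4) unfolding settled_def by simp
  with H(1-3) show ?case by (intro exI[of _ H] conjI)
qed

lemma arith_seq_beyond: "arith_seq beyond"
proof -
  have eq: "fin_set c \<in> beyond m \<longleftrightarrow> (\<exists>x\<in>fin_set c. m < Suc x)" for c m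
    by (simp add: beyond_def less_Suc_eq_le)
  have "definable (\<lambda>e. fin_set (e (Suc 0)) \<in> beyond (e 0))"
    unfolding eq by (intro definable_coding_intros)
  then show ?thesis by (simp add: arith_seq_def beyond_def)
qed

text \<open>Each formula is settled by the arithmetical sequence of its own stage. No definability
  is claimed for the union \<open>D\<close>; absoluteness carries that of forcing over to it, one
  formula at a time.\<close>

lemma settled_exists:
  obtains D where "consistent D" "range beyond \<subseteq> D" "\<And>p. settled D p"
proof -
  let ?P = "\<lambda>n F. arith_seq F \<and> consistent (range F) \<and> range beyond \<subseteq> range F"
  let ?Q = "\<lambda>n F H. range F \<subseteq> range H \<and> settled (range H) (from_nat n)"
  have "\<exists>f. \<forall>n. ?P n (f n) \<and> ?Q n (f n) (f (Suc n))"
  proof (rule dependent_nat_choice)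
    show "\<exists>F. ?P 0 F" using arith_seq_beyond consistent_beyond by blast
  next
    fix F n assume P: "?P n F"
    then have "arith_seq F" "consistent (range F)" by simp_all
    from settle[OF this] obtain H where "arith_seq H \<and> range F \<subseteq> range H \<and> consistent (range H) \<and>
        settled (range H) (from_nat n)" ..
    then show "\<exists>H. ?P (Suc n) H \<and> ?Q n F H" using P subset_trans[of "range beyond" "range F" "range H"]
      by (intro exI[of _ H] conjI) simp_all
  qed
  then obtain f where "\<forall>n. ?P n (f n) \<and> ?Q n (f n) (f (Suc n))" ..
  then have f: "\<And>n. ?P n (f n)" "\<And>n. ?Q n (f n) (f (Suc n))" by simp_all
  define D where "D = (\<Union>n. range (f n))"
  have D: "consistent D" unfolding D_def using f by (intro consistent_UN) simp_all
  have sub: "range (f n) \<subseteq> D" for n unfolding D_def by blast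
  have "settled D p" for p
    using settled_mono[OF _ sub D, of "Suc (to_nat p)" p] f(2)[of "to_nat p"] by simp
  moreover have "range beyond \<subseteq> D" using f(1)[of 0] sub[of 0] by blast
  ultimately show ?thesis using that D by blast
qed

text \<open>Adding the family would reverse the verdict on \<open>FNeg p\<close> while keeping the
  one on \<open>p\<close>, against absoluteness.\<close>

lemma settled_undecided:
  assumes p: "settled D p" "settled D (FNeg p)" and \<sigma>: "finite \<sigma>"
    and S: "{\<rho>. finite \<rho> \<and> force D p i (\<sigma> \<union> \<rho>)} \<notin> D" (is "?S \<notin> D")
  shows "\<not> consistent (insert ?S D)"
proof
  assume con: "consistent (insert ?S D)"
  have sub: "D \<subseteq> insert ?S D" by blast
  have "{\<rho>. finite \<rho> \<and> force (insert ?S D) p i (\<sigma> \<union> \<rho>)} = ?S"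
    using settled_eq[OF p(1) sub con] \<sigma> by auto
  then have "\<not> force (insert ?S D) (FNeg p) i \<sigma>" by simp
  moreover have "force D (FNeg p) i \<sigma>" using S by simp
  ultimately show False using settled_eq[OF p(2) sub con \<sigma>] by blast
qed

section \<open>Big families\<close>

definition sieve :: "nat set \<Rightarrow> (nat \<times> nat) set set \<Rightarrow> nat set set" where
  "sieve X QQ = {\<rho>. finite \<rho> \<and> \<rho> \<subseteq> X \<and> (\<forall>Q\<in>QQ. trans_in Q \<rho>)}"

text \<open>Finitely many demands \<open>(QQ, E)\<close> combine into a single one by taking unions,
  so consistency gives the finite intersection property.\<close>

lemma consistent_ultra:
  assumes D: "consistent D"
  obtains V where "ultra V"
    "\<And>QQ E. finite QQ \<Longrightarrow> finite E \<Longrightarrow> E \<subseteq> D \<Longrightarrow> {z. realizes QQ E z} \<in> V"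
proof -
  let ?I = "{m. finite (fst m) \<and> finite (snd m) \<and> snd m \<subseteq> D}"
  let ?f = "\<lambda>m. {z. realizes (fst m) (snd m) z}"
  have "has_fip (?f ` ?I)"
    unfolding has_fip_def
  proof (intro allI impI)
    fix F assume "finite F" "F \<subseteq> ?f ` ?I"
    from finite_subset_image[OF this] obtain M where M: "M \<subseteq> ?I" "finite M" "F = ?f ` M"
      by (elim exE conjE)
    have QQ: "finite (\<Union>(fst ` M))" and E: "finite (\<Union>(snd ` M))" "\<Union>(snd ` M) \<subseteq> D"
      using M(1,2) by auto
    then obtain z where z: "realizes (\<Union>(fst ` M)) (\<Union>(snd ` M)) z"
      using D unfolding consistent_def by metis
    have "z \<in> ?f m" if "m \<in> M" for m
      using realizes_mono[OF z, of "fst m" "snd m"] that by auto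
    then show "\<Inter>F \<noteq> {}" unfolding M(3) by blast
  qed
  from ultra_exists[OF this] obtain V where V: "?f ` ?I \<subseteq> V" "ultra V" by (elim exE conjE)
  show ?thesis
  proof (rule that[OF V(2)])
    fix QQ :: "(nat \<times> nat) set set" and E :: "nat set set set"
    assume "finite QQ" "finite E" "E \<subseteq> D"
    then have "?f (QQ, E) \<in> ?f ` ?I" by (intro imageI) simp
    then show "{z. realizes QQ E z} \<in> V" using V(1) by auto
  qed
qed

lemma consistent_ultra_nat:
  assumes D: "consistent D" and beyond: "range beyond \<subseteq> D"
  obtains U where "ultra U"
    "\<And>X QQ S. X \<in> U \<Longrightarrow> finite QQ \<Longrightarrow> S \<in> D \<Longrightarrow> sieve X QQ \<inter> S \<noteq> {}"
    "\<And>S. \<not> consistent (insert S D) \<Longrightarrow> \<exists>X QQ. X \<in> U \<and> finite QQ \<and> sieve X QQ \<inter> S = {}"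
proof -
  obtain V where V: "ultra V"
    and real: "\<And>QQ E. finite QQ \<Longrightarrow> finite E \<Longrightarrow> E \<subseteq> D \<Longrightarrow> {z. realizes QQ E z} \<in> V"
    using consistent_ultra[OF D] by blast
  \<comment> \<open>\<open>V\<close> lives on sets of numbers; \<open>X\<close> counts as large when
    \<open>V\<close>-almost every \<open>z\<close> lies inside it.\<close>
  define U where "U = {X. {z. z \<subseteq> X} \<in> V}"
  have meet: "\<exists>z. z \<subseteq> X \<and> realizes QQ E z" if "X \<in> U" "finite QQ" "finite E" "E \<subseteq> D" for X QQ E
  proof -
    have "{z. z \<subseteq> X} \<inter> {z. realizes QQ E z} \<in> V"
      using ultra_Int[OF V _ real[OF that(2-4)]] that(1) by (simp add: U_def)
    from ultra_nonempty[OF V this] show ?thesis by blast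
  qed
  have pos: "sieve X QQ \<inter> S \<noteq> {}" if X: "X \<in> U" and QQ: "finite QQ" and S: "S \<in> D" for X QQ S
  proof -
    obtain z where z: "z \<subseteq> X" "realizes QQ {S} z" using meet[OF X QQ, of "{S}"] S by auto
    then obtain \<rho> where "\<rho> \<in> S" "\<rho> \<subseteq> z" "\<forall>Q\<in>QQ. trans_in Q \<rho>" "finite z"
      by (auto simp: realizes_def hits_def)
    then have "\<rho> \<in> sieve X QQ" using z(1) by (auto simp: sieve_def intro: finite_subset)
    then show ?thesis using \<open>\<rho> \<in> S\<close> by blast
  qed
  have U: "ultra U"
    unfolding ultra_def has_fip_def
  proof (intro conjI allI impI)
    fix F assume F: "finite F" "F \<subseteq> U"
    then have "(\<Inter>X\<in>F. {z. z \<subseteq> X}) \<in> V" by (intro ultra_INT[OF V]) (auto simp: U_def)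
    moreover have "(\<Inter>X\<in>F. {z. z \<subseteq> X}) = {z. z \<subseteq> \<Inter>F}" by auto
    ultimately have "\<Inter>F \<in> U" by (simp add: U_def)
    moreover have "beyond 0 \<in> D" using beyond by blast
    \<comment> \<open>Members of \<open>beyond 0\<close> are nonempty, which excludes an empty
      intersection.\<close>
    ultimately have "sieve (\<Inter>F) {} \<inter> beyond 0 \<noteq> {}" using pos[of "\<Inter>F" "{}"] by simp
    then show "\<Inter>F \<noteq> {}" by (auto simp: sieve_def beyond_def)
  next
    fix X :: "nat set"
    let ?Q = "{(x, x) | x. x \<in> X}"
    have "{z. z \<subseteq> - X} \<in> V" if "{z. z \<subseteq> X} \<notin> V"
    proof (rule ultra_superset[OF V])
      \<comment> \<open>A set homogeneous for the colouring by membership in \<open>X\<close> lies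
        inside \<open>X\<close> or inside its complement.\<close>
      show "- {z. z \<subseteq> X} \<inter> {z. realizes {?Q} {} z} \<in> V"
        using that by (intro ultra_Int[OF V] real) (simp_all add: ultra_compl_iff[OF V])
      show "- {z. z \<subseteq> X} \<inter> {z. realizes {?Q} {} z} \<subseteq> {z. z \<subseteq> - X}"
        unfolding realizes_def homog_def by auto
    qed
    then show "X \<in> U \<or> - X \<in> U" by (auto simp: U_def)
  qed
  have neg: "\<exists>X QQ. X \<in> U \<and> finite QQ \<and> sieve X QQ \<inter> S = {}" if incon: "\<not> consistent (insert S D)" for S
  proof -
    obtain QQ E where QQ: "finite QQ" and E: "finite E" "E \<subseteq> insert S D" and none: "\<And>z. \<not> realizes QQ E z"
      using incon unfolding consistent_def by auto
    let ?A = "\<lambda>Q. {x. (x, x) \<in> Q}"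
    \<comment> \<open>Taking the large colour class of each colouring makes every subset of
      \<open>X\<close> homogeneous. A member of \<open>S\<close> in the sieve could then be joined
      to a realizer of \<open>E - {S}\<close> inside \<open>X\<close>, and the union would realize
      \<open>E\<close>.\<close>
    define X where "X = (\<Inter>Q\<in>QQ. if ?A Q \<in> U then ?A Q else - ?A Q)"
    have X: "X \<in> U" unfolding X_def
      using QQ by (intro ultra_INT[OF U]) (simp_all add: ultra_compl_iff[OF U])
    have homog: "homog Q Y" if "Y \<subseteq> X" "Q \<in> QQ" for Y Q
    proof -
      have "Y \<subseteq> (if ?A Q \<in> U then ?A Q else - ?A Q)" using that unfolding X_def by blast
      then show ?thesis unfolding homog_def by (cases "?A Q \<in> U") auto
    qed
    have "\<rho> \<notin> S" if \<rho>: "\<rho> \<in> sieve X QQ" for \<rho>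
    proof
      assume "\<rho> \<in> S"
      obtain z where z: "z \<subseteq> X" "realizes QQ (E - {S}) z"
        using meet[OF X QQ, of "E - {S}"] E by auto
      have "hits QQ S' (z \<union> \<rho>)" if "S' \<in> E" for S'
      proof (cases "S' = S")
        case True
        then show ?thesis using \<rho> \<open>\<rho> \<in> S\<close> by (auto simp: hits_def sieve_def)
      next
        case False
        then have "hits QQ S' z" using z(2) that by (simp add: realizes_def)
        then show ?thesis by (rule hits_mono) auto
      qed
      moreover have "z \<union> \<rho> \<subseteq> X" "finite (z \<union> \<rho>)"
        using z \<rho> by (auto simp: sieve_def realizes_def)
      ultimately have "realizes QQ E (z \<union> \<rho>)" using homog by (simp add: realizes_def)
      then show False using none by blast
    qed
    then show ?thesis using X QQ by (intro exI[of _ X] exI[of _ QQ]) auto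
  qed
  from that[OF U pos neg] show ?thesis .
qed

text \<open>What the generic construction needs from the ultrafilter. By \<open>big_shrink\<close>,
  a member of the smaller family can be absorbed into the finite part while a big family of further
  extensions remains.\<close>

locale big_families =
  fixes D :: "nat set set set" and big :: "nat set set set"
  assumes D_settled: "settled D p"
    and D_beyond: "beyond m \<in> D"
    and big_nonempty: "big \<noteq> {}"
    and big_Int: "R \<in> big \<Longrightarrow> R' \<in> big \<Longrightarrow> R \<inter> R' \<in> big"
    and big_meets: "R \<in> big \<Longrightarrow> S \<in> D \<Longrightarrow> R \<inter> S \<noteq> {}"
    and big_avoids: "\<not> consistent (insert S D) \<Longrightarrow> \<exists>R\<in>big. R \<inter> S = {}"
    and big_shrink: "R \<in> big \<Longrightarrow>
      \<exists>R'\<in>big. R' \<subseteq> R \<and> (\<forall>\<rho>\<in>R'. \<exists>R''\<in>big. \<forall>\<rho>'\<in>R''. \<rho> \<union> \<rho>' \<in> R)"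
    and big_empty: "R \<in> big \<Longrightarrow> {} \<in> R"
    and big_finite: "R \<in> big \<Longrightarrow> \<rho> \<in> R \<Longrightarrow> finite \<rho>"

text \<open>For each tournament, the ultrafilter fixes whether almost all points have a large
  out-neighbourhood. On \<open>X'\<close> the answer is uniform, so a large set is joined to all
  points of a finite \<open>\<rho>\<close> in one direction, and \<open>trans_in_Un\<close>
  applies.\<close>

lemma sieve_shrink:
  assumes U: "ultra U" and free: "\<And>x. {x} \<notin> U" and X: "X \<in> U" and QQ: "finite QQ"
  shows "\<exists>X'\<in>U. X' \<subseteq> X \<and>
    (\<forall>\<rho>\<in>sieve X' QQ. \<exists>X''\<in>U. \<forall>\<rho>'\<in>sieve X'' QQ. \<rho> \<union> \<rho>' \<in> sieve X QQ)"
proof -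
  let ?up = "\<lambda>Q x. {y. (x, y) \<in> tour Q}"
  define M where "M = (\<lambda>Q. {x. ?up Q x \<in> U})"
  define A where "A = (\<lambda>Q. if M Q \<in> U then M Q else - M Q)"
  \<comment> \<open>The complement of the out-neighbourhood contains \<open>x\<close> itself, so
    \<open>x\<close> is removed; freeness keeps the set in \<open>U\<close>.\<close>
  define Y where "Y = (\<lambda>Q x. (if M Q \<in> U then ?up Q x else - ?up Q x) \<inter> - {x})"
  have A: "A Q \<in> U" for Q unfolding A_def by (simp add: ultra_compl_iff[OF U])
  have Y: "Y Q x \<in> U" if "x \<in> A Q" for Q x
    using that free unfolding Y_def A_def M_def
    by (intro ultra_Int[OF U]) (auto simp: ultra_compl_iff[OF U] split: if_splits)
  define X' where "X' = X \<inter> (\<Inter>Q\<in>QQ. A Q)"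
  have "\<exists>X''\<in>U. \<forall>\<rho>'\<in>sieve X'' QQ. \<rho> \<union> \<rho>' \<in> sieve X QQ" if \<rho>: "\<rho> \<in> sieve X' QQ" for \<rho>
  proof -
    have "finite \<rho>" using \<rho> by (simp add: sieve_def)
    have \<rho>A: "x \<in> A Q" if "x \<in> \<rho>" "Q \<in> QQ" for x Q
      using \<rho> that by (auto simp: sieve_def X'_def)
    define X'' where "X'' = X \<inter> (\<Inter>Q\<in>QQ. \<Inter>x\<in>\<rho>. Y Q x)"
    have "X'' \<in> U"
      unfolding X''_def by (intro ultra_Int[OF U] ultra_INT[OF U] X QQ Y \<rho>A \<open>finite \<rho>\<close>)
    moreover have "\<rho> \<union> \<rho>' \<in> sieve X QQ" if \<rho>': "\<rho>' \<in> sieve X'' QQ" for \<rho>'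
    proof -
      have "trans_in Q (\<rho> \<union> \<rho>')" if Q: "Q \<in> QQ" for Q
      proof (rule trans_in_Un)
        show "trans_in Q \<rho>" "trans_in Q \<rho>'" using \<rho> \<rho>' Q by (auto simp: sieve_def)
        have y: "y \<in> Y Q x" if "x \<in> \<rho>" "y \<in> \<rho>'" for x y
          using \<rho>' Q that unfolding sieve_def X''_def by blast
        show "(x, y) \<in> tour Q \<longleftrightarrow> M Q \<in> U" if "x \<in> \<rho>" "y \<in> \<rho>'" for x y
          using y[OF that] unfolding Y_def by (cases "M Q \<in> U") simp_all
        show "x \<notin> \<rho>'" if "x \<in> \<rho>" for x
          using y[OF that, of x] unfolding Y_def by blast
      qed
      then show ?thesis using \<rho> \<rho>' by (auto simp: sieve_def X'_def X''_def)
    qed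
    ultimately show ?thesis by blast
  qed
  moreover have "X' \<in> U" unfolding X'_def by (intro ultra_Int[OF U] ultra_INT[OF U] X QQ A)
  moreover have "X' \<subseteq> X" unfolding X'_def by blast
  ultimately show ?thesis by (intro bexI[of _ X']) simp_all
qed

text \<open>\<open>D\<close> is obtained without reference to \<open>T\<close>; the tournament
  enters only through one of the sieves.\<close>

lemma big_families_exists:
  obtains D big where "big_families D big" "sieve UNIV {T} \<in> big"
proof -
  obtain D where D: "consistent D" "range beyond \<subseteq> D" "\<And>p. settled D p"
    using settled_exists by blast
  obtain U where U: "ultra U"
    "\<And>X QQ S. X \<in> U \<Longrightarrow> finite QQ \<Longrightarrow> S \<in> D \<Longrightarrow> sieve X QQ \<inter> S \<noteq> {}"
    "\<And>S. \<not> consistent (insert S D) \<Longrightarrow> \<exists>X QQ. X \<in> U \<and> finite QQ \<and> sieve X QQ \<inter> S = {}"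
    by (rule consistent_ultra_nat[OF D(1,2)]) blast
  have free: "{x} \<notin> U" for x
  proof
    assume "{x} \<in> U"
    then have "sieve {x} {} \<inter> beyond (Suc x) \<noteq> {}" using U(2) D(2) by blast
    then show False by (auto simp: sieve_def beyond_def)
  qed
  define big where "big = {sieve X QQ | X QQ. X \<in> U \<and> finite QQ}"
  have bigI: "sieve X QQ \<in> big" if "X \<in> U" "finite QQ" for X QQ
    using that unfolding big_def by blast
  have bigE: "\<exists>X QQ. R = sieve X QQ \<and> X \<in> U \<and> finite QQ" if "R \<in> big" for R
    using that unfolding big_def by blast
  have UNIV: "sieve UNIV {T} \<in> big" by (intro bigI ultra_UNIV U(1)) simp
  have "big_families D big"
  proof
    show "settled D p" for p by (rule D(3))
    show "beyond m \<in> D" for m using D(2) by blast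
    show "big \<noteq> {}" using UNIV by blast
  next
    fix R R' assume "R \<in> big" "R' \<in> big"
    then obtain X QQ X' QQ' where R: "R = sieve X QQ" "X \<in> U" "finite QQ"
      "R' = sieve X' QQ'" "X' \<in> U" "finite QQ'" using bigE by metis
    have "R \<inter> R' = sieve (X \<inter> X') (QQ \<union> QQ')" unfolding R by (auto simp: sieve_def)
    then show "R \<inter> R' \<in> big" using bigI[OF ultra_Int[OF U(1) R(2,5)], of "QQ \<union> QQ'"] R by simp
  next
    fix R S assume "R \<in> big" "S \<in> D"
    then show "R \<inter> S \<noteq> {}" using bigE U(2) by metis
  next
    fix S assume "\<not> consistent (insert S D)"
    then show "\<exists>R\<in>big. R \<inter> S = {}" using U(3) bigI by metis
  next
    fix R assume "R \<in> big"
    then obtain X QQ where R: "R = sieve X QQ" "X \<in> U" "finite QQ" using bigE by metis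
    obtain X' where X': "X' \<in> U" "X' \<subseteq> X"
      "\<And>\<rho>. \<rho> \<in> sieve X' QQ \<Longrightarrow> \<exists>X''\<in>U. \<forall>\<rho>'\<in>sieve X'' QQ. \<rho> \<union> \<rho>' \<in> sieve X QQ"
      using sieve_shrink[OF U(1) free R(2,3)] by metis
    show "\<exists>R'\<in>big. R' \<subseteq> R \<and> (\<forall>\<rho>\<in>R'. \<exists>R''\<in>big. \<forall>\<rho>'\<in>R''. \<rho> \<union> \<rho>' \<in> R)"
    proof (rule bexI[of _ "sieve X' QQ"], intro conjI ballI)
      show "sieve X' QQ \<in> big" using bigI X'(1) R(3) by simp
      show "sieve X' QQ \<subseteq> R" using X'(2) R(1) by (auto simp: sieve_def)
      fix \<rho> assume "\<rho> \<in> sieve X' QQ"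
      from X'(3)[OF this] obtain X'' where "X'' \<in> U" "\<forall>\<rho>'\<in>sieve X'' QQ. \<rho> \<union> \<rho>' \<in> R"
        unfolding R(1) ..
      then show "\<exists>R''\<in>big. \<forall>\<rho>'\<in>R''. \<rho> \<union> \<rho>' \<in> R" using bigI R(3) by blast
    qed
  next
    fix R assume "R \<in> big"
    then show "{} \<in> R" using bigE[of R] by (auto simp: sieve_def trans_in_def)
  next
    fix R \<rho> assume "R \<in> big" "\<rho> \<in> R"
    then show "finite \<rho>" using bigE[of R] by (auto simp: sieve_def)
  qed
  then show ?thesis using UNIV by (rule that)
qed

section \<open>Generic sets\<close>

text \<open>The negation clause refers to \<open>force\<close>, so it mentions only \<open>D\<close>
  and the members of \<open>R\<close>, never other conditions.\<close>

primrec cforce :: "nat set set set \<Rightarrow> form \<Rightarrow> nat \<Rightarrow> nat set \<Rightarrow> nat set set \<Rightarrow> bool" where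
  "cforce D (FLess s t) i \<sigma> R \<longleftrightarrow> val (env i) s < val (env i) t"
| "cforce D (FOracle t) i \<sigma> R \<longleftrightarrow> val (env i) t \<in> \<sigma>"
| "cforce D (FNeg p) i \<sigma> R \<longleftrightarrow> (\<forall>\<rho>\<in>R. \<not> force D p i (\<sigma> \<union> \<rho>))"
| "cforce D (FConj p q) i \<sigma> R \<longleftrightarrow> cforce D p i \<sigma> R \<and> cforce D q i \<sigma> R"
| "cforce D (FEx p) i \<sigma> R \<longleftrightarrow> (\<exists>a. cforce D p (prod_encode (a, i)) \<sigma> R)"

lemma cforce_extend:
  "cforce D p i \<sigma> R \<Longrightarrow> \<forall>\<rho>'\<in>R'. \<rho> \<union> \<rho>' \<in> R \<Longrightarrow> cforce D p i (\<sigma> \<union> \<rho>) R'"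
  by (induction p arbitrary: i) (auto simp: Un_assoc)

lemma cforce_subset: "cforce D p i \<sigma> R \<Longrightarrow> R' \<subseteq> R \<Longrightarrow> cforce D p i \<sigma> R'"
  using cforce_extend[of D p i \<sigma> R R' "{}"] by auto

text \<open>Conditions are pairs of a finite set and a big family of admissible extensions.\<close>

definition ext :: "nat set \<times> nat set set \<Rightarrow> nat set \<times> nat set set \<Rightarrow> bool" where
  "ext c' c \<longleftrightarrow> (\<exists>\<rho>. fst c' = fst c \<union> \<rho> \<and> (\<forall>\<rho>'\<in>snd c'. \<rho> \<union> \<rho>' \<in> snd c))"

lemma ext_refl: "ext c c"
  unfolding ext_def by (intro exI[of _ "{}"]) simp

lemma ext_trans:
  assumes "ext c c'" "ext c' c''"
  shows "ext c c''"
proof -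
  obtain \<rho> \<rho>' where "fst c = fst c' \<union> \<rho>" "\<forall>\<tau>\<in>snd c. \<rho> \<union> \<tau> \<in> snd c'"
    "fst c' = fst c'' \<union> \<rho>'" "\<forall>\<tau>\<in>snd c'. \<rho>' \<union> \<tau> \<in> snd c''"
    using assms unfolding ext_def by (elim exE conjE)
  then show ?thesis unfolding ext_def by (intro exI[of _ "\<rho>' \<union> \<rho>"]) (auto simp: Un_assoc)
qed

lemma ext_fst: "ext c' c \<Longrightarrow> fst c \<subseteq> fst c'"
  unfolding ext_def by auto

abbreviation forces :: "nat set set set \<Rightarrow> nat set \<times> nat set set \<Rightarrow> form \<Rightarrow> nat \<Rightarrow> bool" where
  "forces D c p i \<equiv> cforce D p i (fst c) (snd c)"

lemma forces_ext: "forces D c p i \<Longrightarrow> ext c' c \<Longrightarrow> forces D c' p i"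
  unfolding ext_def by (elim exE conjE) (simp add: cforce_extend)

section \<open>Conditions, their extensions and the generic sequence\<close>

context big_families
begin

definition cond :: "nat set \<times> nat set set \<Rightarrow> bool" where
  "cond c \<longleftrightarrow> finite (fst c) \<and> snd c \<in> big"

text \<open>By \<open>big_avoids\<close> and \<open>big_meets\<close>, a family from the negation
  clause lies outside \<open>D\<close> exactly when some big family avoids it. So
  \<open>force\<close>, which sees only \<open>D\<close>, tells what conditions with a given finite
  part can force.\<close>

lemma force_iff: "finite \<sigma> \<Longrightarrow> force D p i \<sigma> \<longleftrightarrow> (\<exists>R\<in>big. cforce D p i \<sigma> R)"
proof (induction p arbitrary: i)
  case (FNeg p)
  let ?S = "{\<rho>. finite \<rho> \<and> force D p i (\<sigma> \<union> \<rho>)}"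
  show ?case
  proof
    assume "force D (FNeg p) i \<sigma>"
    then have "\<not> consistent (insert ?S D)" using settled_undecided D_settled FNeg.prems by simp
    then obtain R where "R \<in> big" "R \<inter> ?S = {}" using big_avoids by metis
    then show "\<exists>R\<in>big. cforce D (FNeg p) i \<sigma> R" using big_finite by (intro bexI[of _ R]) auto
  next
    assume "\<exists>R\<in>big. cforce D (FNeg p) i \<sigma> R"
    then obtain R where R: "R \<in> big" "\<forall>\<rho>\<in>R. \<not> force D p i (\<sigma> \<union> \<rho>)" by auto
    then have "R \<inter> ?S = {}" by auto
    then show "force D (FNeg p) i \<sigma>" using big_meets[OF R(1)] by auto
  qed
next
  case (FConj p q)
  show ?case
  proof
    assume "force D (FConj p q) i \<sigma>"
    then obtain R R' where "R \<in> big" "cforce D p i \<sigma> R" "R' \<in> big" "cforce D q i \<sigma> R'"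
      using FConj by auto
    then show "\<exists>R\<in>big. cforce D (FConj p q) i \<sigma> R"
      using big_Int by (intro bexI[of _ "R \<inter> R'"]) (auto intro: cforce_subset)
  qed (use FConj in auto)
qed (use big_nonempty in auto)

text \<open>Shrinking comes first, so that the member of \<open>S\<close> then found leaves a big
  family for later extensions.\<close>

lemma cond_extend:
  assumes c: "cond c" and S: "S \<in> D"
  obtains c' \<rho> where "\<rho> \<in> S" "cond c'" "ext c' c" "fst c' = fst c \<union> \<rho>"
proof -
  obtain R where R: "R \<in> big" "\<And>\<rho>. \<rho> \<in> R \<Longrightarrow> \<exists>R''\<in>big. \<forall>\<rho>'\<in>R''. \<rho> \<union> \<rho>' \<in> snd c"
    using big_shrink[of "snd c"] c unfolding cond_def by metis
  obtain \<rho> where \<rho>: "\<rho> \<in> R" "\<rho> \<in> S" using big_meets[OF R(1) S] by blast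
  obtain R'' where R'': "R'' \<in> big" "\<forall>\<rho>'\<in>R''. \<rho> \<union> \<rho>' \<in> snd c" using R(2)[OF \<rho>(1)] by blast
  show ?thesis
  proof (rule that[OF \<rho>(2)])
    show "cond (fst c \<union> \<rho>, R'')" using c R'' big_finite[OF R(1) \<rho>(1)] by (simp add: cond_def)
    show "ext (fst c \<union> \<rho>, R'') c" using R'' by (auto simp: ext_def)
  qed simp
qed

lemma cond_Int:
  assumes "cond c" "R \<in> big"
  shows "cond (fst c, snd c \<inter> R)" "ext (fst c, snd c \<inter> R) c"
  using assms big_Int by (auto simp: cond_def ext_def intro!: exI[of _ "{}"])

text \<open>If the negation is not forced, the family of extensions forcing \<open>p\<close> belongs
  to \<open>D\<close>, and \<open>cond_extend\<close> can enter it.\<close>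

lemma extend_forces:
  assumes c: "cond c" and nf: "\<not> force D (FNeg p) i (fst c)"
  obtains c' where "cond c'" "ext c' c" "forces D c' p i"
proof -
  have S: "{\<rho>. finite \<rho> \<and> force D p i (fst c \<union> \<rho>)} \<in> D" using nf by simp
  obtain c' \<rho> where c': "\<rho> \<in> {\<rho>. finite \<rho> \<and> force D p i (fst c \<union> \<rho>)}" "cond c'" "ext c' c"
    "fst c' = fst c \<union> \<rho>"
    by (rule cond_extend[OF c S])
  then obtain R where R: "R \<in> big" "cforce D p i (fst c') R"
    using force_iff[of "fst c'" p i] by (auto simp: cond_def)
  show ?thesis
    using that[OF cond_Int(1)[OF c'(2) R(1)] ext_trans[OF cond_Int(2)[OF c'(2) R(1)] c'(3)]]
      cforce_subset[OF R(2)] by simp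
qed

lemma extend_forces_neg:
  assumes c: "cond c" and f: "force D (FNeg p) i (fst c)"
  obtains c' where "cond c'" "ext c' c" "forces D c' (FNeg p) i"
proof -
  obtain R where R: "R \<in> big" "cforce D (FNeg p) i (fst c) R"
    using f c force_iff[of "fst c" "FNeg p" i] unfolding cond_def by blast
  show ?thesis
    using that[OF cond_Int[OF c R(1)]] cforce_subset[OF R(2), of "snd c \<inter> R"] by simp
qed

lemma extend_decide:
  assumes "cond c"
  obtains c' where "cond c'" "ext c' c" "forces D c' p i \<or> forces D c' (FNeg p) i"
  using extend_forces[OF assms, of p i] extend_forces_neg[OF assms, of p i] by blast

text \<open>The finite part enters as a fixed code \<open>u\<close>, so the set of \<open>x\<close>
  at which the negation is not forced is arithmetical and differs from \<open>B\<close> at some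
  \<open>x\<close>. Either kind of difference can be secured by an extension.\<close>

lemma extend_diagonal:
  assumes B: "\<not> arithmetic B" and c: "cond c"
  obtains c' x where "cond c'" "ext c' c"
    "forces D c' p (prod_encode (x, 0)) \<and> x \<notin> B \<or> forces D c' (FNeg p) (prod_encode (x, 0)) \<and> x \<in> B"
proof -
  have "finite (fst c)" using c by (simp add: cond_def)
  from fin_set_surj[OF this] obtain u where u: "fin_set u = fst c" ..
  have "definable (\<lambda>e. \<not> force D (FNeg p) (prod_encode (e 0, 0)) (fin_set u))"
    by (intro definable_not definable_force[OF D_settled] definable_fun_prod_encode
      definable_fun_var definable_fun_const)
  then have "arithmetic {x. \<not> force D (FNeg p) (prod_encode (x, 0)) (fst c)}"
    unfolding u by (rule definable_imp_arithmetic)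
  then have "{x. \<not> force D (FNeg p) (prod_encode (x, 0)) (fst c)} \<noteq> B" using B by metis
  then obtain x where "(x \<in> B) = force D (FNeg p) (prod_encode (x, 0)) (fst c)" by auto
  then consider "x \<in> B" "force D (FNeg p) (prod_encode (x, 0)) (fst c)"
    | "x \<notin> B" "\<not> force D (FNeg p) (prod_encode (x, 0)) (fst c)" by blast
  then show ?thesis
  proof cases
    case 1
    from extend_forces_neg[OF c this(2)] that 1(1) show ?thesis by metis
  next
    case 2
    from extend_forces[OF c this(2)] that 2(1) show ?thesis by metis
  qed
qed

text \<open>The three requirements serve, in order, the infinitude of the generic set, the
  equivalence of truth and forcing, and the failure of the formula numbered \<open>n\<close> to
  define \<open>B\<close>.\<close>

definition task :: "nat set \<Rightarrow> nat \<Rightarrow> nat set \<times> nat set set \<Rightarrow> bool" where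
  "task B n c \<longleftrightarrow>
     (\<exists>x\<in>fst c. n \<le> x) \<and>
     (let (m, i) = prod_decode n; p = from_nat m in forces D c p i \<or> forces D c (FNeg p) i) \<and>
     (\<exists>x. forces D c (from_nat n) (prod_encode (x, 0)) \<and> x \<notin> B \<or>
          forces D c (FNeg (from_nat n)) (prod_encode (x, 0)) \<and> x \<in> B)"

lemma extend_task:
  assumes B: "\<not> arithmetic B" and c: "cond c"
  shows "\<exists>c'. cond c' \<and> ext c' c \<and> task B n c'"
proof -
  obtain m i where n: "prod_decode n = (m, i)" by force
  obtain c1 \<rho> where c1: "\<rho> \<in> beyond n" "cond c1" "ext c1 c" "fst c1 = fst c \<union> \<rho>"
    using cond_extend[OF c D_beyond] by blast
  then obtain x where x: "x \<in> fst c1" "n \<le> x" by (auto simp: beyond_def)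
  obtain c2 where c2: "cond c2" "ext c2 c1"
    "forces D c2 (from_nat m) i \<or> forces D c2 (FNeg (from_nat m)) i"
    using extend_decide[OF c1(2)] by blast
  obtain c3 y where c3: "cond c3" "ext c3 c2"
    "forces D c3 (from_nat n) (prod_encode (y, 0)) \<and> y \<notin> B \<or>
     forces D c3 (FNeg (from_nat n)) (prod_encode (y, 0)) \<and> y \<in> B"
    by (rule extend_diagonal[OF B c2(1)])
  have "forces D c3 (from_nat m) i \<or> forces D c3 (FNeg (from_nat m)) i"
    using c2(3) forces_ext[OF _ c3(2)] by blast
  moreover have "x \<in> fst c3" using x(1) ext_fst[OF c2(2)] ext_fst[OF c3(2)] by blast
  ultimately have "task B n c3" unfolding task_def n using x(2) c3(3) by auto
  then show ?thesis using c3(1) ext_trans[OF c3(2) ext_trans[OF c2(2) c1(3)]] by blast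
qed

text \<open>For negation, \<open>dec\<close> ensures that one of \<open>p\<close> and
  \<open>FNeg p\<close> is forced. Both cannot be: a common later condition would force both, and
  \<open>{}\<close> in its big family gives a contradiction.\<close>

lemma generic_truth:
  fixes c :: "nat \<Rightarrow> nat set \<times> nat set set"
  assumes c: "\<And>n. cond (c n)" and mono: "\<And>m n. m \<le> n \<Longrightarrow> ext (c n) (c m)"
    and dec: "\<And>p i. \<exists>n. forces D (c n) p i \<or> forces D (c n) (FNeg p) i"
  shows "fsat (\<Union>n. fst (c n)) p i \<longleftrightarrow> (\<exists>n. forces D (c n) p i)"
proof (induction p arbitrary: i)
  case (FNeg p)
  have "\<not> forces D (c m) p i" if neg: "forces D (c n) (FNeg p) i" for m n
  proof
    assume pos: "forces D (c m) p i"
    let ?c = "c (max m n)"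
    have "forces D ?c p i" "forces D ?c (FNeg p) i"
      using forces_ext[OF pos mono[of m "max m n"]] forces_ext[OF neg mono[of n "max m n"]]
      by simp_all
    moreover have "finite (fst ?c)" "snd ?c \<in> big" using c[of "max m n"] by (simp_all add: cond_def)
    ultimately have "force D p i (fst ?c)" "\<not> force D p i (fst ?c \<union> {})"
      using force_iff[of "fst ?c" p i] big_empty[of "snd ?c"] unfolding cforce.simps by blast+
    then show False by simp
  qed
  then show ?case using FNeg dec[of p i] by (metis fsat.simps(3))
next
  case (FConj p q)
  have "\<exists>n. forces D (c n) (FConj p q) i" if "forces D (c m) p i" "forces D (c n) q i" for m n
    using forces_ext[OF that(1) mono[of m "max m n"]] forces_ext[OF that(2) mono[of n "max m n"]]
    by (intro exI[of _ "max m n"]) simp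
  then show ?case using FConj by auto
qed auto

lemma generic_exists:
  assumes B: "\<not> arithmetic B" and T: "sieve UNIV {T} \<in> big"
  shows "\<exists>H. infinite H \<and> trans_in T H \<and> \<not> arithmetic_in H B"
proof -
  let ?c0 = "({}, sieve UNIV {T})"
  have c0: "cond ?c0" using T by (simp add: cond_def)
  have "\<exists>c. \<forall>n. (cond (c n) \<and> ext (c n) ?c0) \<and> (ext (c (Suc n)) (c n) \<and> task B n (c (Suc n)))"
  proof (rule dependent_nat_choice)
    show "\<exists>c. cond c \<and> ext c ?c0" using c0 ext_refl by blast
  next
    fix c n assume "cond c \<and> ext c ?c0"
    then have c: "cond c" "ext c ?c0" by simp_all
    from extend_task[OF B c(1), of n] obtain c' where "cond c' \<and> ext c' c \<and> task B n c'" ..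
    then show "\<exists>c'. (cond c' \<and> ext c' ?c0) \<and> (ext c' c \<and> task B n c')"
      using ext_trans[OF _ c(2)] by (intro exI[of _ c']) simp
  qed
  then obtain c where "\<forall>n. (cond (c n) \<and> ext (c n) ?c0) \<and> (ext (c (Suc n)) (c n) \<and> task B n (c (Suc n)))" ..
  then have c: "\<And>n. cond (c n)" "\<And>n. ext (c n) ?c0" "\<And>n. ext (c (Suc n)) (c n)" "\<And>n. task B n (c (Suc n))"
    by simp_all
  have mono: "ext (c n) (c m)" if "m \<le> n" for m n
    using that by (induction rule: dec_induct) (auto intro: ext_refl ext_trans c(3))
  define H where "H = (\<Union>n. fst (c n))"
  have "\<exists>n. forces D (c n) p i \<or> forces D (c n) (FNeg p) i" for p i
    using c(4)[of "prod_encode (to_nat p, i)"] unfolding task_def by auto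
  then have truth: "fsat H p i \<longleftrightarrow> (\<exists>n. forces D (c n) p i)" for p i
    unfolding H_def using generic_truth[of c] c(1) mono by blast
  have "\<exists>x\<in>H. n \<le> x" for n
    using c(4)[of n] unfolding task_def H_def by blast
  then have "infinite H" by (metis finite_nat_set_iff_bounded not_le)
  moreover have "trans_in T H"
  proof -
    have tr: "trans_in T (fst (c n))" for n
    proof -
      have "{} \<in> snd (c n)" using c(1)[of n] big_empty by (simp add: cond_def)
      \<comment> \<open>Adding the empty admissible extension shows that the finite part itself
        belongs to the initial sieve.\<close>
      then have "fst (c n) \<in> sieve UNIV {T}" using c(2)[of n] by (auto simp: ext_def)
      then show ?thesis by (simp add: sieve_def)
    qed
    have sub: "fst (c m) \<subseteq> fst (c n)" if "m \<le> n" for m n using ext_fst[OF mono[OF that]] .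
    show ?thesis
      unfolding trans_in_def
    proof (intro ballI impI)
      fix x y w assume "x \<in> H" "y \<in> H" "w \<in> H" and arrows: "(x, y) \<in> tour T" "(y, w) \<in> tour T"
      then obtain k l m where "x \<in> fst (c k)" "y \<in> fst (c l)" "w \<in> fst (c m)" unfolding H_def by blast
      then have "x \<in> fst (c (k + l + m))" "y \<in> fst (c (k + l + m))" "w \<in> fst (c (k + l + m))"
        using sub[of k "k + l + m"] sub[of l "k + l + m"] sub[of m "k + l + m"] by auto
      then show "(x, w) \<in> tour T" using tr[of "k + l + m"] arrows unfolding trans_in_def by blast
    qed
  qed
  moreover have "\<not> arithmetic_in H B"
  proof
    assume "arithmetic_in H B"
    then obtain p where "defines_set H p B" unfolding arithmetic_in_def Sigma_in_def by blast
    then have p: "x \<in> B \<longleftrightarrow> fsat H (form_of p) (prod_encode (x, 0))" for x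
      unfolding defines_set_def by simp
    obtain x where "forces D (c (Suc (to_nat (form_of p)))) (form_of p) (prod_encode (x, 0)) \<and> x \<notin> B \<or>
        forces D (c (Suc (to_nat (form_of p)))) (FNeg (form_of p)) (prod_encode (x, 0)) \<and> x \<in> B"
      using c(4)[of "to_nat (form_of p)"] unfolding task_def from_nat_to_nat by blast
    then have "fsat H (form_of p) (prod_encode (x, 0)) \<and> x \<notin> B \<or>
        fsat H (FNeg (form_of p)) (prod_encode (x, 0)) \<and> x \<in> B"
      using truth by blast
    then show False using p[of x] by auto
  qed
  ultimately show ?thesis by blast
qed

end

theorem theorem1:
  fixes B :: "nat set"
  assumes "\<not> arithmetic B"
  shows "\<forall>T. tournament_on UNIV T \<longrightarrow>
           (\<exists>H. infinite H \<and> transitive_subdomain T H \<and> \<not> arithmetic_in H B)"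
proof (intro allI impI)
  fix T :: "(nat \<times> nat) set"
  assume T: "tournament_on UNIV T"
  obtain D big where "big_families D big" "sieve UNIV {T} \<in> big" by (rule big_families_exists)
  then obtain H where H: "infinite H" "trans_in T H" "\<not> arithmetic_in H B"
    using big_families.generic_exists[OF _ assms] by blast
  have "transitive_subdomain T H"
    unfolding transitive_subdomain_def subtournament_def
    using H(2) by (auto simp: trans_in_def tour_tournament[OF T] intro!: transI)
  with H show "\<exists>H. infinite H \<and> transitive_subdomain T H \<and> \<not> arithmetic_in H B" by blast
qed

end
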